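(* Let $M,\tilde M$ be smooth oriented $n$-dimensional Riemannian manifolds, $0\le k\le n$, and let $f:M\to\tilde M$ be a diffeomorphism. Suppose $1\le p\le\tilde p<\infty$ and put $t=\frac{p}{\tilde p-p}$ ($t=\infty$ if $p=\tilde p$). Then for every $\omega\in L^{\tilde p}(\tilde M,\Lambda^k)$, $$\|f^*\omega\|_{L^p(M,\Lambda^k)}\le\big(K_{\tilde p,t,k}(f)\big)^{1/\tilde p}\,\|\omega\|_{L^{\tilde p}(\tilde M,\Lambda^k)}.$$ In particular, if $f\in \mathrm{BD}^k_{(\tilde p,t)}(M,\tilde M)$, i.e. $K_{\tilde p,t,k}(f)<\infty$, then the operator $f^*:L^{\tilde p}(\tilde M,\Lambda^k)\to L^p(M,\Lambda^k)$ is bounded.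
   Context: $L^p(M,\Lambda^k)$ is the Banach space of measurable (locally integrable) $k$-forms $\theta$ with $\|\theta\|_p=(\int_M|\theta|^p\,dx)^{1/p}<\infty$, where $|\theta|$ is the pointwise norm induced by the Riemannian metric (multivectors $e_{i_1}\wedge\dots\wedge e_{i_k}$, $i_1<\dots<i_k$, of an orthonormal basis being orthonormal) and $dx$ is the Riemannian volume. For a diffeomorphism $f:M\to\tilde M$ and $x\in M$, let $\lambda_1(x),\dots,\lambda_n(x)>0$ be the singular values of $df_x$. Put $\sigma_0(f,x)=1$, $\sigma_m(f,x)=\sum_{i_1<\dots<i_m}\lambda_{i_1}(x)\cdots\lambda_{i_m}(x)$, and $J_f(x)=\sigma_n(f,x)=\lambda_1(x)\cdots\lambda_n(x)$. For $1\le s<\infty$ and $0<t\le\infty$, $$K_{s,t,m}(f)=\left\|\frac{(\sigma_m(f))^s}{J_f}\right\|_{L^t(M)}\in[0,\infty],$$ where $\|u\|_{L^t}=(\int_M|u|^tdx)^{1/t}$ for $t<\infty$ (also when $t<1$) and the essential supremum for $t=\infty$. One writes $f\in \mathrm{BD}^m_{(s,t)}(M,\tilde M)$ if $K_{s,t,m}(f)<\infty$. The inequality is regarded as vacuous when $K_{\tilde p,t,k}(f)=\infty$. *)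

theory Defs
  imports "HOL-Analysis.Analysis" "HOL-Probability.Essential_Supremum"
begin

section \<open>Smooth oriented Riemannian manifolds\<close>

primrec Ck_on :: "'a::real_normed_vector set \<Rightarrow> nat \<Rightarrow> ('a \<Rightarrow> 'b::real_normed_vector) \<Rightarrow> bool" where
  "Ck_on S 0 f \<longleftrightarrow> continuous_on S f"
| "Ck_on S (Suc k) f \<longleftrightarrow>
     (\<forall>x\<in>S. f differentiable (at x)) \<and> (\<forall>v. Ck_on S k (\<lambda>x. frechet_derivative f (at x) v))"

text \<open>Only meaningful for open \<open>S\<close>, which is how it is used.\<close>
definition smooth_on :: "'a::real_normed_vector set \<Rightarrow> ('a \<Rightarrow> 'b::real_normed_vector) \<Rightarrow> bool" where
  "smooth_on S f \<longleftrightarrow> (\<forall>k. Ck_on S k f)"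

type_synonym ('a, 'n) chart = "'a set \<times> ('a \<Rightarrow> real ^ 'n)"

abbreviation chart_dom :: "('a, 'n) chart \<Rightarrow> 'a set" where "chart_dom c \<equiv> fst c"
abbreviation chart_im :: "('a, 'n) chart \<Rightarrow> (real ^ 'n) set" where "chart_im c \<equiv> snd c ` fst c"
abbreviation coord :: "('a, 'n) chart \<Rightarrow> 'a \<Rightarrow> real ^ 'n" where "coord c \<equiv> snd c"
abbreviation param :: "('a, 'n) chart \<Rightarrow> real ^ 'n \<Rightarrow> 'a" where "param c \<equiv> inv_into (fst c) (snd c)"

text \<open>
  The points of a manifold are all elements of the type \<open>'a\<close>; its dimension is \<open>CARD('n)\<close>.

  The tangent space at \<open>x\<close> is modelled by \<open>real ^ 'n\<close>: a vector \<open>v\<close> stands for the tangent vector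
  with components \<open>v\<close> in one chart \<open>chart_at M x\<close> around \<open>x\<close>, chosen once and for all. This choice
  need not depend on \<open>x\<close> in any regular way, so regularity of tensor fields is always expressed in
  the charts of the atlas, through \<open>coord_vec\<close> below.
\<close>
record ('a, 'n) riem =
  atlas :: "('a, 'n) chart set"
  metric :: "'a \<Rightarrow> real ^ 'n \<Rightarrow> real ^ 'n \<Rightarrow> real"

definition chart_at :: "('a, 'n::finite) riem \<Rightarrow> 'a \<Rightarrow> ('a, 'n) chart" where
  "chart_at M x = (SOME c. c \<in> atlas M \<and> x \<in> chart_dom c)"

text \<open>The element of the tangent space at \<open>x\<close> whose components in the chart \<open>c\<close> are \<open>v\<close>.\<close>
definition coord_vec ::
    "('a, 'n::finite) riem \<Rightarrow> ('a, 'n) chart \<Rightarrow> 'a \<Rightarrow> real ^ 'n \<Rightarrow> real ^ 'n" where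
  "coord_vec M c x v =
     frechet_derivative (coord (chart_at M x) \<circ> param c) (at (coord c x)) v"

definition oriented_smooth_atlas ::
    "('a::{t2_space,second_countable_topology}, 'n::finite) chart set \<Rightarrow> bool" where
  "oriented_smooth_atlas A \<longleftrightarrow>
     (\<Union>c\<in>A. chart_dom c) = UNIV \<and>
     (\<forall>c\<in>A. open (chart_dom c) \<and> open (chart_im c) \<and> homeomorphism (chart_dom c) (chart_im c) (coord c) (param c)) \<and>
     (\<forall>c\<in>A. \<forall>d\<in>A. smooth_on (coord c ` (chart_dom c \<inter> chart_dom d)) (coord d \<circ> param c) \<and>
        (\<forall>y\<in>coord c ` (chart_dom c \<inter> chart_dom d).
           det (matrix (frechet_derivative (coord d \<circ> param c) (at y))) > 0))"

definition is_inner_product :: "(real ^ 'n::finite \<Rightarrow> real ^ 'n \<Rightarrow> real) \<Rightarrow> bool" where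
  "is_inner_product G \<longleftrightarrow>
     bilinear G \<and> (\<forall>u v. G u v = G v u) \<and> (\<forall>v. v \<noteq> 0 \<longrightarrow> G v v > 0)"

definition oriented_riemannian_manifold ::
    "('a::{t2_space,second_countable_topology}, 'n::finite) riem \<Rightarrow> bool" where
  "oriented_riemannian_manifold M \<longleftrightarrow>
     oriented_smooth_atlas (atlas M) \<and>
     (\<forall>x. is_inner_product (metric M x)) \<and>
     (\<forall>c\<in>atlas M. \<forall>u v. smooth_on (chart_im c)
        (\<lambda>y. metric M (param c y) (coord_vec M c (param c y) u) (coord_vec M c (param c y) v)))"

definition smooth_map ::
    "('a::topological_space, 'n::finite) riem \<Rightarrow> ('b::topological_space, 'n) riem \<Rightarrow> ('a \<Rightarrow> 'b) \<Rightarrow> bool" where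
  "smooth_map M N f \<longleftrightarrow>
     continuous_on UNIV f \<and>
     (\<forall>c\<in>atlas M. \<forall>d\<in>atlas N.
        smooth_on (coord c ` (chart_dom c \<inter> f -` chart_dom d)) (coord d \<circ> f \<circ> param c))"

definition diffeomorphism ::
    "('a::topological_space, 'n::finite) riem \<Rightarrow> ('b::topological_space, 'n) riem \<Rightarrow> ('a \<Rightarrow> 'b) \<Rightarrow> bool" where
  "diffeomorphism M N f \<longleftrightarrow> bij f \<and> smooth_map M N f \<and> smooth_map N M (inv f)"

text \<open>The differential at \<open>x\<close>, from the tangent space at \<open>x\<close> to the one at \<open>f x\<close>.\<close>
definition differential ::
    "('a, 'n::finite) riem \<Rightarrow> ('b, 'n) riem \<Rightarrow> ('a \<Rightarrow> 'b) \<Rightarrow> 'a \<Rightarrow> real ^ 'n \<Rightarrow> real ^ 'n" where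
  "differential M N f x =
     frechet_derivative (coord (chart_at N (f x)) \<circ> f \<circ> param (chart_at M x))
       (at (coord (chart_at M x) x))"

section \<open>Riemannian volume and Lebesgue norms\<close>

definition measurable_sets :: "('a, 'n::finite) riem \<Rightarrow> 'a set set" where
  "measurable_sets M = {S. \<forall>c\<in>atlas M. coord c ` (S \<inter> chart_dom c) \<in> sets lebesgue}"

text \<open>The function \<open>sqrt (det (g_ij))\<close> in the chart \<open>c\<close>.\<close>
definition volume_density ::
    "('a, 'n::finite) riem \<Rightarrow> ('a, 'n) chart \<Rightarrow> real ^ 'n \<Rightarrow> real" where
  "volume_density M c y =
     (let x = param c y in
      sqrt (det (\<chi> i j. metric M x (coord_vec M c x (axis i 1)) (coord_vec M c x (axis j 1)))))"

text \<open>
  The prescribed values on measurable subsets of chart domains are consistent by the change of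
  variables formula, and they determine the measure because the manifold is second countable.
\<close>
definition volume :: "('a, 'n::finite) riem \<Rightarrow> 'a measure" where
  "volume M = (THE \<mu>. space \<mu> = UNIV \<and> sets \<mu> = measurable_sets M \<and>
     (\<forall>c\<in>atlas M. \<forall>S\<in>measurable_sets M. S \<subseteq> chart_dom c \<longrightarrow>
        emeasure \<mu> S = (\<integral>\<^sup>+y\<in>coord c ` S. ennreal (volume_density M c y) \<partial>lebesgue)))"

text \<open>The power \<open>x\<close> to the \<open>a\<close> for a positive real exponent \<open>a\<close>.\<close>
definition epowr :: "ennreal \<Rightarrow> real \<Rightarrow> ennreal" where
  "epowr x a = (if x = \<infinity> then \<infinity> else ennreal (enn2real x powr a))"

definition Lnorm :: "'a measure \<Rightarrow> ennreal \<Rightarrow> ('a \<Rightarrow> real) \<Rightarrow> ennreal" where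
  "Lnorm \<mu> t u =
     (if t = \<infinity> then esssup \<mu> (\<lambda>x. ennreal \<bar>u x\<bar>)
      else epowr (\<integral>\<^sup>+x. ennreal (\<bar>u x\<bar> powr enn2real t) \<partial>\<mu>) (1 / enn2real t))"

section \<open>Differential forms\<close>

text \<open>
  A \<open>k\<close>-covector takes an infinite sequence of vectors as its argument, but depends only on the
  first \<open>k\<close> of them.
\<close>
definition alternating_form :: "nat \<Rightarrow> ((nat \<Rightarrow> real ^ 'n) \<Rightarrow> real) \<Rightarrow> bool" where
  "alternating_form k \<alpha> \<longleftrightarrow>
     (\<forall>v w. (\<forall>i<k. v i = w i) \<longrightarrow> \<alpha> v = \<alpha> w) \<and>
     (\<forall>v. \<forall>i<k. linear (\<lambda>u. \<alpha> (v(i := u)))) \<and>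
     (\<forall>v. \<forall>i<k. \<forall>j<k. i \<noteq> j \<and> v i = v j \<longrightarrow> \<alpha> v = 0)"

type_synonym ('a, 'n) form = "'a \<Rightarrow> (nat \<Rightarrow> real ^ 'n) \<Rightarrow> real"

definition orthonormal_frame ::
    "(real ^ 'n \<Rightarrow> real ^ 'n \<Rightarrow> real) \<Rightarrow> ('n \<Rightarrow> real ^ 'n) \<Rightarrow> bool" where
  "orthonormal_frame G e \<longleftrightarrow> (\<forall>i j. G (e i) (e j) = (if i = j then 1 else 0))"

text \<open>
  The Euclidean norm of the components of the \<open>k\<close>-covector \<open>\<alpha>\<close> on the multivectors
  \<open>e i\<^sub>1 \<and> \<dots> \<and> e i\<^sub>k\<close>, \<open>i\<^sub>1 < \<dots> < i\<^sub>k\<close>, of an orthonormal basis \<open>e\<close>; it does not depend on \<open>e\<close>.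
\<close>
definition covector_norm ::
    "(real ^ ('n::{finite,wellorder}) \<Rightarrow> real ^ ('n::{finite,wellorder}) \<Rightarrow> real) \<Rightarrow> nat \<Rightarrow>
     ((nat \<Rightarrow> real ^ ('n::{finite,wellorder})) \<Rightarrow> real) \<Rightarrow> real" where
  "covector_norm G k \<alpha> =
     (let e = (SOME e. orthonormal_frame G e) in
      sqrt (\<Sum>I | card I = k. (\<alpha> (\<lambda>j. e (sorted_list_of_set I ! j)))\<^sup>2))"

definition measurable_form :: "('a, 'n::finite) riem \<Rightarrow> nat \<Rightarrow> ('a, 'n) form \<Rightarrow> bool" where
  "measurable_form M k \<omega> \<longleftrightarrow>
     (\<forall>x. alternating_form k (\<omega> x)) \<and>
     (\<forall>c\<in>atlas M. \<forall>v.
        (\<lambda>y. \<omega> (param c y) (\<lambda>j. coord_vec M c (param c y) (v j)))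
          \<in> borel_measurable (lebesgue_on (chart_im c)))"

definition form_norm ::
    "('a, 'n::{finite,wellorder}) riem \<Rightarrow> real \<Rightarrow> nat \<Rightarrow> ('a, 'n) form \<Rightarrow> ennreal" where
  "form_norm M p k \<omega> = Lnorm (volume M) (ennreal p) (\<lambda>x. covector_norm (metric M x) k (\<omega> x))"

text \<open>
  For \<open>p \<ge> 1\<close>, local integrability follows from finiteness of the norm. Forms which agree almost
  everywhere are not identified here; see \<open>bounded_form_operator\<close>.
\<close>
definition Lp_forms ::
    "('a, 'n::{finite,wellorder}) riem \<Rightarrow> real \<Rightarrow> nat \<Rightarrow> ('a, 'n) form set" where
  "Lp_forms M p k = {\<omega>. measurable_form M k \<omega> \<and> form_norm M p k \<omega> < \<infinity>}"

definition pullback ::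
    "('a, 'n::finite) riem \<Rightarrow> ('b, 'n) riem \<Rightarrow> ('a \<Rightarrow> 'b) \<Rightarrow> ('b, 'n) form \<Rightarrow> ('a, 'n) form" where
  "pullback M N f \<omega> = (\<lambda>x v. \<omega> (f x) (\<lambda>j. differential M N f x (v j)))"

text \<open>
  \<open>T\<close> induces a bounded linear operator from \<open>L\<^sup>q\<close>-forms on \<open>N\<close> to \<open>L\<^sup>p\<close>-forms on \<open>M\<close> (both of degree
  \<open>k\<close>), where forms equal almost everywhere are identified: the second conjunct says that \<open>T\<close>
  descends to the equivalence classes.
\<close>
definition bounded_form_operator ::
    "('b, 'n::{finite,wellorder}) riem \<Rightarrow> real \<Rightarrow> ('a, 'n) riem \<Rightarrow> real \<Rightarrow> nat \<Rightarrow>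
     (('b, 'n) form \<Rightarrow> ('a, 'n) form) \<Rightarrow> bool" where
  "bounded_form_operator N q M p k T \<longleftrightarrow>
     (\<forall>\<omega>\<in>Lp_forms N q k. T \<omega> \<in> Lp_forms M p k) \<and>
     (\<forall>\<omega>\<in>Lp_forms N q k. \<forall>\<eta>\<in>Lp_forms N q k.
        (AE y in volume N. \<omega> y = \<eta> y) \<longrightarrow> (AE x in volume M. T \<omega> x = T \<eta> x)) \<and>
     (\<forall>\<omega>\<in>Lp_forms N q k. \<forall>\<eta>\<in>Lp_forms N q k. \<forall>a b.
        T (\<lambda>y v. a * \<omega> y v + b * \<eta> y v) = (\<lambda>x v. a * T \<omega> x v + b * T \<eta> x v)) \<and>
     (\<exists>C::real. \<forall>\<omega>\<in>Lp_forms N q k. form_norm M p k (T \<omega>) \<le> ennreal C * form_norm N q k \<omega>)"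

section \<open>Distortion of diffeomorphisms\<close>

text \<open>
  \<open>\<sigma>\<close> lists, with multiplicity, the singular values of \<open>L\<close>, from the inner product \<open>G\<close> to the inner
  product \<open>H\<close>: there is a \<open>G\<close>-orthonormal basis of eigenvectors \<open>e i\<close> of \<open>L\<^sup>* L\<close> with eigenvalues
  \<open>(\<sigma> i)\<^sup>2\<close>, the adjoint being characterised by \<open>G (L\<^sup>* w) v = H w (L v)\<close>.
\<close>
definition singular_values ::
    "(real ^ 'n \<Rightarrow> real ^ 'n \<Rightarrow> real) \<Rightarrow> (real ^ 'n \<Rightarrow> real ^ 'n \<Rightarrow> real) \<Rightarrow>
     (real ^ 'n \<Rightarrow> real ^ 'n) \<Rightarrow> ('n \<Rightarrow> real) \<Rightarrow> bool" where
  "singular_values G H L \<sigma> \<longleftrightarrow>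
     (\<forall>i. \<sigma> i \<ge> 0) \<and>
     (\<exists>e. orthonormal_frame G e \<and> (\<forall>i v. H (L (e i)) (L v) = (\<sigma> i)\<^sup>2 * G (e i) v))"

text \<open>Singular values are unique up to order, so their symmetric functions are well defined.\<close>
definition sigma ::
    "('a, 'n::finite) riem \<Rightarrow> ('b, 'n) riem \<Rightarrow> nat \<Rightarrow> ('a \<Rightarrow> 'b) \<Rightarrow> 'a \<Rightarrow> real" where
  "sigma M N m f x =
     (let \<sigma> = (SOME \<sigma>. singular_values (metric M x) (metric N (f x)) (differential M N f x) \<sigma>) in
      \<Sum>I | card I = m. \<Prod>i\<in>I. \<sigma> i)"

definition jacobian ::
    "('a, 'n::finite) riem \<Rightarrow> ('b, 'n) riem \<Rightarrow> ('a \<Rightarrow> 'b) \<Rightarrow> 'a \<Rightarrow> real" where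
  "jacobian M N f x = sigma M N CARD('n) f x"

definition distortion ::
    "('a, 'n::finite) riem \<Rightarrow> ('b, 'n) riem \<Rightarrow> real \<Rightarrow> ennreal \<Rightarrow> nat \<Rightarrow> ('a \<Rightarrow> 'b) \<Rightarrow> ennreal" where
  "distortion M N s t m f =
     Lnorm (volume M) t (\<lambda>x. sigma M N m f x powr s / jacobian M N f x)"

definition BD ::
    "('a::topological_space, 'n::finite) riem \<Rightarrow> ('b::topological_space, 'n) riem \<Rightarrow>
     real \<Rightarrow> ennreal \<Rightarrow> nat \<Rightarrow> ('a \<Rightarrow> 'b) set" where
  "BD M N s t m = {f. diffeomorphism M N f \<and> distortion M N s t m f < \<infinity>}"

end

theory Submission
  imports Defs
begin

text \<open>
  Evaluating on an orthonormal basis of singular vectors gives \<open>\<bar>f\<^sup>* \<omega>\<bar> \<le> \<sigma>\<^sub>k \<cdot> (\<bar>\<omega>\<bar> \<circ> f)\<close> pointwise.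
  Hence \<open>\<bar>f\<^sup>* \<omega>\<bar>\<^sup>p \<le> (\<sigma>\<^sub>k\<^sup>q / J) powr (p / q) \<cdot> (J \<cdot> (\<bar>\<omega>\<bar> \<circ> f)\<^sup>q) powr (p / q)\<close>, and the estimate
  follows from Hoelder's inequality and the change of variables \<open>\<integral>\<^sub>M J \<cdot> (u \<circ> f) = \<integral>\<^sub>N u\<close>.
  Measurability of \<open>\<sigma>\<^sub>k\<close> is not needed: Hoelder's inequality is applied with the measurable function
  \<open>(\<bar>f\<^sup>* \<omega>\<bar> / (\<bar>\<omega>\<bar> \<circ> f))\<^sup>p \<cdot> J powr (- p / q)\<close>, which the first factor dominates.
\<close>

section \<open>Orthonormal frames and singular values\<close>

text \<open>Tangent vectors are components in an arbitrarily chosen chart, frames and singular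
  values come from \<open>SOME\<close>, the volume from \<open>THE\<close>. Continuity and
  measurability cannot be read off such choices, so each is replaced by an expression free of them.
  The squared covector norm is taken over all tuples of frame vectors instead of the increasing
  ones; up to \<open>fact k\<close> this is a polynomial in the components and the inverse Gram
  matrix. The Jacobian becomes a determinant times a quotient of roots of Gram determinants. The
  volume is built, and shown unique, by cutting the manifold into countably many disjoint pieces,
  each inside one chart. The change of variables in one pair of charts is proved once for a
  diffeomorphism. For the identity it makes the values prescribed in overlapping charts agree; for
  \<open>f\<close> it shows that the image of J times the volume of \<open>M\<close> has the
  defining property of the volume of \<open>N\<close>. The Hoelder exponents q / (q - p) and q / p
  are conjugate: the second restores J times the q-th power of the norm of \<omega> along
  \<open>f\<close>, the first turns the power p / q of the distortion quotient into the power
  t.\<close>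

definition gram :: "(real ^ 'n \<Rightarrow> real ^ 'n \<Rightarrow> real) \<Rightarrow> real ^ ('n::finite) ^ 'n" where
  "gram G = (\<chi> i j. G (axis i 1) (axis j 1))"

section \<open>Diagonalisation of symmetric bilinear forms\<close>

lemma compact_orthogonal_matrices: "compact {U :: real ^ ('n::finite) ^ 'n. orthogonal_matrix U}"
proof -
  have "bounded {U :: real ^ 'n ^ 'n. orthogonal_matrix U}"
  proof (rule boundedI)
    fix U :: "real^'n^'n" assume "U \<in> {U. orthogonal_matrix U}"
    then have "norm (row i U) = 1" for i
      by (simp add: orthogonal_matrix_orthonormal_rows)
    then have "norm (U $ i) = 1" for i by (simp add: row_def)
    then show "norm U \<le> (\<Sum>i::'n\<in>UNIV. 1)"
      using L2_set_le_sum[of UNIV "\<lambda>i. norm (U $ i)"] by (simp add: norm_vec_def)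
  qed
  moreover have "closed {U :: real ^ 'n ^ 'n. orthogonal_matrix U}"
    unfolding orthogonal_matrix matrix_matrix_mult_def transpose_def vec_eq_iff
    by (simp, intro closed_Collect_all closed_Collect_eq continuous_intros)
  ultimately show ?thesis by (simp add: compact_eq_bounded_closed)
qed

lemma sum_two_split:
  fixes g :: "'n::finite \<Rightarrow> real"
  assumes "i \<noteq> j"
  shows "(\<Sum>m\<in>UNIV. g m) = g i + g j + (\<Sum>m\<in>UNIV - {i, j}. g m)"
proof -
  have "(\<Sum>m\<in>UNIV. g m) = (\<Sum>m\<in>{i,j}. g m) + (\<Sum>m\<in>UNIV - {i, j}. g m)"
    by (metis add.commute finite_class.finite_UNIV sum.subset_diff top_greatest)
  then show ?thesis using assms by simp
qed

text \<open>Halving the angle of the unit vector (x, y). It supplies the Jacobi rotation, whose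
  effect on a symmetric 2 by 2 block is governed by the double angle.\<close>

lemma double_angle_exists:
  fixes x y :: real
  assumes "x\<^sup>2 + y\<^sup>2 = 1"
  obtains c s where "c\<^sup>2 + s\<^sup>2 = 1" "c\<^sup>2 - s\<^sup>2 = x" "2 * c * s = y"
proof -
  obtain t where t: "x = cos t" "y = sin t" using assms sincos_total_2pi by metis
  have "x = (cos (t/2))\<^sup>2 - (sin (t/2))\<^sup>2" "y = 2 * cos (t/2) * sin (t/2)"
    using cos_double[of "t/2"] sin_double[of "t/2"] t by auto
  then show ?thesis using that[of "cos (t/2)" "sin (t/2)"] by simp
qed

text \<open>
  A maximiser of the sum of the squares of the diagonal entries is diagonal: otherwise a Jacobi
  rotation, which annihilates an off-diagonal entry \<open>b\<close>, increases this sum by \<open>2 b\<^sup>2\<close>.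
\<close>
lemma symmetric_bilinear_diagonalizable:
  fixes B :: "real ^ ('n::finite) \<Rightarrow> real ^ 'n \<Rightarrow> real"
  assumes B: "bilinear B" and sym: "\<And>u v. B u v = B v u"
  obtains u where "orthonormal_frame (\<bullet>) u" "\<And>i j. i \<noteq> j \<Longrightarrow> B (u i) (u j) = 0"
proof -
  define K where "K = {U :: real ^ 'n ^ 'n. orthogonal_matrix U}"
  define \<phi> where "\<phi> U = (\<Sum>i\<in>UNIV. (B (U $ i) (U $ i))\<^sup>2)" for U :: "real ^ 'n ^ 'n"
  have bb: "bounded_bilinear B" using B by (simp add: bilinear_conv_bounded_bilinear)
  have "continuous_on K \<phi>" unfolding \<phi>_def
    by (intro continuous_intros bounded_bilinear.continuous_on[OF bb])
  moreover have "compact K" unfolding K_def by (rule compact_orthogonal_matrices)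
  moreover have "K \<noteq> {}" using orthogonal_matrix_id by (auto simp: K_def)
  ultimately obtain U where U: "U \<in> K" "\<And>V. V \<in> K \<Longrightarrow> \<phi> V \<le> \<phi> U"
    using continuous_attains_sup[of K \<phi>] by blast
  have K_iff: "V \<in> K \<longleftrightarrow> (\<forall>i j. V $ i \<bullet> V $ j = (if i = j then 1 else 0))" for V
    unfolding K_def orthogonal_matrix_orthonormal_rows
    by (auto simp: row_def orthogonal_def norm_eq_1 split: if_splits)
  have "B (U $ i) (U $ j) = 0" if ij: "i \<noteq> j" for i j
  proof (rule ccontr)
    define a b d where "a = B (U $ i) (U $ i)" and "b = B (U $ i) (U $ j)" and "d = B (U $ j) (U $ j)"
    assume "B (U $ i) (U $ j) \<noteq> 0"
    then have "b \<noteq> 0" by (simp add: b_def)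
    \<comment> \<open>The double angle of the rotation is the angle of the vector (a - d, 2 * b), of
      length r. This makes r the difference of the two new diagonal entries.\<close>
    define r where "r = sqrt ((a - d)\<^sup>2 + 4 * b\<^sup>2)"
    have r2: "r\<^sup>2 = (a - d)\<^sup>2 + 4 * b\<^sup>2" unfolding r_def by simp
    have "0 < (a - d)\<^sup>2 + 4 * b\<^sup>2" using \<open>b \<noteq> 0\<close> by (simp add: add_nonneg_pos)
    then have "r \<noteq> 0" using r2 by auto
    have "((a - d) / r)\<^sup>2 + (2 * b / r)\<^sup>2 = 1"
      using \<open>r \<noteq> 0\<close> 
      by (simp add: power_divide power_mult_distrib r2[symmetric] flip: add_divide_distrib)
    then obtain c s where cs: "c\<^sup>2 + s\<^sup>2 = 1" "c\<^sup>2 - s\<^sup>2 = (a - d) / r" "2 * c * s = 2 * b / r"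
      by (rule double_angle_exists)
    define V where "V = (\<chi> m. if m = i then c *\<^sub>R U $ i + s *\<^sub>R U $ j
      else if m = j then - s *\<^sub>R U $ i + c *\<^sub>R U $ j else U $ m)"
    have Vi: "V $ i = c *\<^sub>R U $ i + s *\<^sub>R U $ j" and Vj: "V $ j = - s *\<^sub>R U $ i + c *\<^sub>R U $ j"
      and Vm: "\<And>m. m \<noteq> i \<Longrightarrow> m \<noteq> j \<Longrightarrow> V $ m = U $ m"
      using ij by (auto simp: V_def)
    have UU: "U $ m \<bullet> U $ l = (if m = l then 1 else 0)" for m l using U(1) K_iff by blast
    have "V \<in> K"
      unfolding K_iff
    proof (intro allI)
      fix m l
      have "c * c + s * s = 1" using cs(1) by (simp add: power2_eq_square)
      then show "V $ m \<bullet> V $ l = (if m = l then 1 else 0)"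
        using ij by (auto simp: V_def inner_add_left inner_add_right inner_diff_left inner_diff_right UU)
    qed
    then have le: "\<phi> V \<le> \<phi> U" by (rule U(2))
    define a' d' where "a' = B (V $ i) (V $ i)" and "d' = B (V $ j) (V $ j)"
    have ji: "B (U $ j) (U $ i) = b" using sym b_def by simp
    have a': "a' = c\<^sup>2 * a + (2 * c * s) * b + s\<^sup>2 * d" and d': "d' = s\<^sup>2 * a - (2 * c * s) * b + c\<^sup>2 * d"
      unfolding a'_def d'_def Vi Vj
      by (simp_all add: bilinear_ladd[OF B] bilinear_radd[OF B] bilinear_lmul[OF B]
          bilinear_rmul[OF B] bilinear_lneg[OF B] bilinear_rneg[OF B] ji bilinear_lsub[OF B] bilinear_rsub[OF B]
          flip: a_def b_def d_def) (simp_all add: power2_eq_square algebra_simps)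
    have "a' + d' = (c\<^sup>2 + s\<^sup>2) * (a + d)" unfolding a' d' by (simp add: algebra_simps)
    then have sum: "a' + d' = a + d" using cs(1) by simp
    have "a' - d' = (c\<^sup>2 - s\<^sup>2) * (a - d) + 2 * (2 * c * s) * b" unfolding a' d' by (simp add: algebra_simps)
    also have "\<dots> = ((a - d)\<^sup>2 + 4 * b\<^sup>2) / r" unfolding cs
      by (simp add: power2_eq_square add_divide_distrib)
    finally have diff: "a' - d' = r" unfolding r2[symmetric] using \<open>r \<noteq> 0\<close> by (simp add: power2_eq_square)
    \<comment> \<open>The sum of the two entries is unchanged, while the square of their difference
      grows by 4 * b^2; the parallelogram identity converts this into the gain for the sum of
      squares.\<close>
    have "2 * (a'\<^sup>2 + d'\<^sup>2) = (a' + d')\<^sup>2 + (a' - d')\<^sup>2" by (simp add: power2_eq_square algebra_simps)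
    also have "\<dots> = 2 * (a\<^sup>2 + d\<^sup>2) + 4 * b\<^sup>2" unfolding sum diff r2 by (simp add: power2_eq_square algebra_simps)
    finally have gt: "a'\<^sup>2 + d'\<^sup>2 = a\<^sup>2 + d\<^sup>2 + 2 * b\<^sup>2" by simp
    have "\<phi> V = a'\<^sup>2 + d'\<^sup>2 + (\<Sum>m\<in>UNIV - {i, j}. (B (V $ m) (V $ m))\<^sup>2)"
      unfolding \<phi>_def a'_def d'_def by (rule sum_two_split[OF ij])
    also have "(\<Sum>m\<in>UNIV - {i, j}. (B (V $ m) (V $ m))\<^sup>2) = (\<Sum>m\<in>UNIV - {i, j}. (B (U $ m) (U $ m))\<^sup>2)"
      by (intro sum.cong) (auto simp: Vm)
    finally have "\<phi> V = \<phi> U + 2 * b\<^sup>2"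
      unfolding \<phi>_def[of U] sum_two_split[OF ij, of "\<lambda>m. (B (U $ m) (U $ m))\<^sup>2"] using gt
      by (simp add: a_def d_def)
    then show False using le \<open>b \<noteq> 0\<close> by simp
  qed
  moreover have "orthonormal_frame (\<bullet>) (\<lambda>i. U $ i)"
    unfolding orthonormal_frame_def using U(1) K_iff by blast
  ultimately show ?thesis using that by blast
qed

section \<open>Orthonormal frames and Gram matrices\<close>

lemma inner_product_bilinear: "is_inner_product G \<Longrightarrow> bilinear G"
  and inner_product_sym: "is_inner_product G \<Longrightarrow> G u v = G v u"
  and inner_product_pos: "is_inner_product G \<Longrightarrow> v \<noteq> 0 \<Longrightarrow> G v v > 0"
  by (auto simp: is_inner_product_def)

text \<open>A Euclidean-orthonormal basis that diagonalises \<open>G\<close> consists of nonzero,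
  pairwise \<open>G\<close>-orthogonal vectors, so it only has to be rescaled.\<close>

lemma orthonormal_frame_exists:
  fixes G :: "real ^ ('n::finite) \<Rightarrow> real ^ 'n \<Rightarrow> real"
  assumes G: "is_inner_product G"
  obtains e where "orthonormal_frame G e"
proof -
  note B = inner_product_bilinear[OF G]
  obtain u where u: "orthonormal_frame (\<bullet>) u" "\<And>i j. i \<noteq> j \<Longrightarrow> G (u i) (u j) = 0"
    using symmetric_bilinear_diagonalizable[OF B inner_product_sym[OF G]] by blast
  have "u i \<noteq> 0" for i using u(1) unfolding orthonormal_frame_def
    by (metis inner_zero_left zero_neq_one)
  then have pos: "G (u i) (u i) > 0" for i using inner_product_pos[OF G] by blast
  then have "G (u i) (u i) / (sqrt (G (u i) (u i)) * sqrt (G (u i) (u i))) = 1" for i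
    using pos[of i] by (simp add: less_imp_neq[symmetric] abs_of_pos)
  then have "orthonormal_frame G (\<lambda>i. (1 / sqrt (G (u i) (u i))) *\<^sub>R u i)"
    unfolding orthonormal_frame_def
    by (auto simp: bilinear_lmul[OF B] bilinear_rmul[OF B] u(2))
  then show ?thesis using that by blast
qed

lemma bilinear_gram:
  fixes G :: "real ^ ('n::finite) \<Rightarrow> real ^ 'n \<Rightarrow> real"
  assumes B: "bilinear G"
  shows "G v w = (\<Sum>i\<in>UNIV. \<Sum>j\<in>UNIV. v $ i * w $ j * gram G $ i $ j)"
proof -
  have "G v w = G (\<Sum>i\<in>UNIV. v $ i *\<^sub>R axis i 1) (\<Sum>j\<in>UNIV. w $ j *\<^sub>R axis j 1)"
    using basis_expansion[of v] basis_expansion[of w] by (simp add: scalar_mult_eq_scaleR)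
  then show ?thesis
    by (simp add: bilinear_sum[OF B] sum.cartesian_product gram_def bilinear_lmul[OF B] bilinear_rmul[OF B]
      mult_ac)
qed

lemma gram_columns:
  fixes G :: "real ^ ('n::finite) \<Rightarrow> real ^ 'n \<Rightarrow> real"
  assumes B: "bilinear G"
  shows "(\<chi> i j. G (column i E) (column j E)) = transpose E ** gram G ** E"
proof -
  have "G (column i E) (column j E) = (\<Sum>b\<in>UNIV. (\<Sum>a\<in>UNIV. E $ a $ i * gram G $ a $ b) * E $ b $ j)" for i j
    unfolding bilinear_gram[OF B, of "column i E"] sum_distrib_right
    by (subst sum.swap) (simp add: column_def mult_ac)
  then show ?thesis
    by (simp add: vec_eq_iff matrix_matrix_mult_def transpose_def)
qed

lemma gram_linear_image:
  fixes G :: "real ^ ('n::finite) \<Rightarrow> real ^ 'n \<Rightarrow> real"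
  assumes B: "bilinear G" and A: "linear A"
  shows "gram (\<lambda>v w. G (A v) (A w)) = transpose (matrix A) ** gram G ** matrix A"
proof -
  have "column i (matrix A) = A (axis i 1)" for i
    by (simp add: column_def matrix_def vec_eq_iff)
  then show ?thesis using gram_columns[OF B, of "matrix A"] by (simp add: gram_def)
qed

lemma matrix_inv_unique_left:
  fixes A B :: "real ^ ('n::finite) ^ 'n"
  assumes "B ** A = mat 1"
  shows "matrix_inv A = B"
proof -
  have "invertible A" using assms invertible_left_inverse by blast
  then have "matrix_inv A ** A = mat 1" "A ** matrix_inv A = mat 1"
    unfolding matrix_inv_def invertible_def by (auto intro: someI2_ex)
  then have "B = (B ** A) ** matrix_inv A" by (simp flip: matrix_mul_assoc)
  then show ?thesis using assms by simp
qed

text \<open>For the matrix \<open>E\<close> with the frame as columns, orthonormality is the first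
  equation; the others follow by determinants and cancellation. The last one shows that
  \<open>E ** transpose E\<close> is the same for all frames, which is the source of the frame
  independence of the covector norm.\<close>

lemma orthonormal_frame_gram:
  fixes G :: "real ^ ('n::finite) \<Rightarrow> real ^ 'n \<Rightarrow> real"
  assumes B: "bilinear G" and e: "orthonormal_frame G e"
  defines "E \<equiv> (\<chi> i j. e j $ i)"
  shows "transpose E ** gram G ** E = mat 1" "det (gram G) * (det E)\<^sup>2 = 1"
    "det (gram G) > 0" "matrix_inv (gram G) = E ** transpose E"
proof -
  have "column i E = e i" for i by (simp add: E_def column_def)
  then show 1: "transpose E ** gram G ** E = mat 1"
    using gram_columns[OF B, of E] e by (simp add: orthonormal_frame_def mat_def)
  then have "det (transpose E ** gram G ** E) = 1" by simp
  then show 2: "det (gram G) * (det E)\<^sup>2 = 1"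
    by (simp add: det_mul det_transpose power2_eq_square mult_ac)
  then show "det (gram G) > 0"
    by (smt (verit) mult_nonpos_nonneg zero_le_power2)
  have "E ** (transpose E ** gram G) = mat 1" using 1 matrix_left_right_inverse by blast
  then have "(E ** transpose E) ** gram G = mat 1" by (simp add: matrix_mul_assoc)
  then show "matrix_inv (gram G) = E ** transpose E"
    by (simp add: matrix_inv_unique_left)
qed

lemma matrix_inv_gram:
  fixes G :: "real ^ ('n::finite) \<Rightarrow> real ^ 'n \<Rightarrow> real"
  assumes "bilinear G" and "orthonormal_frame G e"
  shows "matrix_inv (gram G) $ a $ b = (\<Sum>i\<in>UNIV. e i $ a * e i $ b)"
  using orthonormal_frame_gram(4)[OF assms] by (simp add: matrix_matrix_mult_def transpose_def)

lemma det_gram_pos: "is_inner_product G \<Longrightarrow> det (gram G) > 0"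
  by (metis orthonormal_frame_exists orthonormal_frame_gram(3) inner_product_bilinear)

section \<open>Singular values with respect to two inner products\<close>

lemma bilinear_compose_linear:
  assumes "bilinear H" "linear A" "linear A'"
  shows "bilinear (\<lambda>v w. H (A v) (A' w))"
  using assms unfolding bilinear_def
  by (auto intro: linear_compose[unfolded o_def])

lemma inner_product_linear_image:
  assumes G: "is_inner_product G" and A: "linear A" "inj A"
  shows "is_inner_product (\<lambda>v w. G (A v) (A w))"
  using G bilinear_compose_linear[OF _ A(1) A(1)] A(2) linear_injective_0[OF A(1)]
  unfolding is_inner_product_def by blast

text \<open>A \<open>G\<close>-orthonormal frame gives an isometry \<open>A\<close> from Euclidean
  space. The form \<open>H\<close> pulled back along \<open>L\<close> and \<open>A\<close> is
  symmetric and nonnegative; an orthonormal basis diagonalising it is carried by \<open>A\<close> to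
  a singular frame, and the roots of its diagonal entries are the singular values.\<close>

lemma singular_values_exist:
  fixes G H :: "real ^ ('n::finite) \<Rightarrow> real ^ 'n \<Rightarrow> real"
  assumes G: "is_inner_product G" and H: "is_inner_product H" and L: "linear L"
  obtains \<sigma> where "singular_values G H L \<sigma>"
proof -
  obtain e where e: "orthonormal_frame G e" using orthonormal_frame_exists[OF G] .
  define A where "A x = (\<Sum>i\<in>UNIV. (x :: real^'n) $ i *\<^sub>R e i)" for x
  have A: "linear A"
    unfolding A_def by (intro linearI) (simp_all add: scaleR_left_distrib sum.distrib scaleR_sum_right)
  note BG = inner_product_bilinear[OF G] and BH = inner_product_bilinear[OF H]
  have GA: "G (A x) (A y) = x \<bullet> y" for x y
  proof -
    have "G (A x) (A y) = (\<Sum>i\<in>UNIV. \<Sum>j\<in>UNIV. if j = i then x $ i * y $ j else 0)"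
      using e unfolding A_def orthonormal_frame_def sum.cartesian_product
      by (subst bilinear_sum[OF BG])
        (auto simp: bilinear_lmul[OF BG] bilinear_rmul[OF BG] intro!: sum.cong)
    then show ?thesis by (simp add: inner_vec_def)
  qed
  define B where "B x y = H (L (A x)) (L (A y))" for x y
  have LA: "linear (\<lambda>x. L (A x))" using linear_compose[OF A L] by (simp add: o_def)
  have "bilinear B" unfolding B_def by (rule bilinear_compose_linear[OF BH LA LA])
  moreover have "B u v = B v u" for u v unfolding B_def by (rule inner_product_sym[OF H])
  ultimately obtain u where u: "orthonormal_frame (\<bullet>) u" "\<And>i j. i \<noteq> j \<Longrightarrow> B (u i) (u j) = 0"
    using symmetric_bilinear_diagonalizable by blast
  define \<sigma> where "\<sigma> i = sqrt (B (u i) (u i))" for i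
  have Bnn: "B x x \<ge> 0" for x
    using inner_product_pos[OF H, of "L (A x)"] bilinear_lzero[OF BH, of 0]
    by (cases "L (A x) = 0") (auto simp: B_def)
  have frame: "orthonormal_frame G (\<lambda>i. A (u i))"
    using u(1) GA by (simp add: orthonormal_frame_def)
  have "inj A"
    unfolding linear_injective_0[OF A]
  proof (intro allI impI)
    fix x assume "A x = 0"
    then have "x \<bullet> x = 0" using GA[of x x] bilinear_lzero[OF BG, of 0] by simp
    then show "x = 0" by simp
  qed
  then have "surj A" using linear_injective_imp_surjective[OF A] by simp
  have "H (L (A (u i))) (L v) = (\<sigma> i)\<^sup>2 * G (A (u i)) v" for i v
  proof -
    obtain x where x: "v = A x" using \<open>surj A\<close> by (metis surjD)
    define E where "E = (\<chi> i. u i)"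
    have "orthogonal_matrix E"
      using u(1) unfolding orthogonal_matrix_orthonormal_rows orthonormal_frame_def E_def
      by (auto simp: row_def orthogonal_def norm_eq_1)
    then have 1: "transpose E ** E = mat 1" by (simp add: orthogonal_matrix)
    \<comment> \<open>The eigenvector equation is demanded against every vector, not only the basis
      vectors; expanding \<open>x\<close> in the orthonormal basis \<open>u\<close> leaves just the
      diagonal term.\<close>
    have "x = transpose E *v (E *v x)" by (simp add: matrix_vector_mul_assoc 1)
    also have "\<dots> = (\<Sum>j\<in>UNIV. (u j \<bullet> x) *\<^sub>R u j)"
      by (simp add: vec_eq_iff matrix_vector_mult_def E_def transpose_def inner_vec_def mult.commute)
    finally have xe: "x = (\<Sum>j\<in>UNIV. (u j \<bullet> x) *\<^sub>R u j)" .
    have "linear (B (u i))" using \<open>bilinear B\<close> by (simp add: bilinear_def)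
    then have "B (u i) x = (\<Sum>j\<in>UNIV. (u j \<bullet> x) * B (u i) (u j))"
      by (subst xe) (simp add: linear_sum linear_cmul)
    also have "\<dots> = (u i \<bullet> x) * B (u i) (u i)"
      using u(2) by (subst sum.remove[of _ i]) (auto intro!: sum.neutral)
    finally show ?thesis by (simp add: x GA B_def[symmetric] \<sigma>_def Bnn)
  qed
  then have "singular_values G H L \<sigma>"
    unfolding singular_values_def using frame Bnn by (auto simp: \<sigma>_def)
  then show ?thesis using that by blast
qed

text \<open>The \<open>H\<close>-Gram matrix of the images of a singular frame is diagonal with the
  squared singular values as entries. Its determinant factors through those of
  \<open>matrix L\<close>, \<open>gram H\<close> and the frame matrix \<open>E\<close>, and the
  square of \<open>det E\<close> is the inverse of \<open>det (gram G)\<close>. The right-hand side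
  does not mention \<sigma>, so it remains usable when \<sigma> comes from
  \<open>SOME\<close>.\<close>

lemma prod_singular_values:
  fixes G H :: "real ^ ('n::finite) \<Rightarrow> real ^ 'n \<Rightarrow> real"
  assumes G: "is_inner_product G" and H: "is_inner_product H" and L: "linear L"
    and \<sigma>: "singular_values G H L \<sigma>"
  shows "(\<Prod>i\<in>UNIV. \<sigma> i) = \<bar>det (matrix L)\<bar> * sqrt (det (gram H)) / sqrt (det (gram G))"
proof -
  note BG = inner_product_bilinear[OF G] and BH = inner_product_bilinear[OF H]
  obtain e where e: "orthonormal_frame G e" and \<sigma>e: "\<And>i v. H (L (e i)) (L v) = (\<sigma> i)\<^sup>2 * G (e i) v"
    and nn: "\<And>i. \<sigma> i \<ge> 0"
    using \<sigma> unfolding singular_values_def by blast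
  define E :: "real^'n^'n" where "E = (\<chi> i j. e j $ i)"
  have c: "column i E = e i" for i by (simp add: E_def column_def)
  have LE: "column i (matrix L ** E) = L (e i)" for i
  proof -
    have "column i (matrix L ** E) = matrix L *v column i E"
      by (simp add: vec_eq_iff column_def matrix_matrix_mult_def matrix_vector_mult_def)
    then show ?thesis using L by (simp add: c matrix_works linear_matrix_vector_mul_eq)
  qed
  have "(\<chi> i j. H (column i (matrix L ** E)) (column j (matrix L ** E))) = (\<chi> i j. if i = j then (\<sigma> i)\<^sup>2 else 0)"
    using e by (simp add: LE \<sigma>e orthonormal_frame_def vec_eq_iff)
  then have "transpose (matrix L ** E) ** gram H ** (matrix L ** E) = (\<chi> i j. if i = j then (\<sigma> i)\<^sup>2 else 0)"
    by (simp add: gram_columns[OF BH])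
  then have "det (transpose (matrix L ** E) ** gram H ** (matrix L ** E)) = (\<Prod>i\<in>UNIV. (\<sigma> i)\<^sup>2)"
    by (simp add: det_diagonal)
  then have 1: "(det (matrix L))\<^sup>2 * det (gram H) * (det E)\<^sup>2 = (\<Prod>i\<in>UNIV. \<sigma> i)\<^sup>2"
    by (simp add: det_mul det_transpose power2_eq_square mult_ac prod.distrib)
  have 2: "det (gram G) * (det E)\<^sup>2 = 1" and "det (gram G) > 0"
    using orthonormal_frame_gram[OF BG e] by (auto simp: E_def)
  then have "(det E)\<^sup>2 = 1 / det (gram G)" by (simp add: field_simps)
  then have "(\<Prod>i\<in>UNIV. \<sigma> i)\<^sup>2 = (det (matrix L))\<^sup>2 * det (gram H) / det (gram G)"
    using 1 by simp
  then have "sqrt ((\<Prod>i\<in>UNIV. \<sigma> i)\<^sup>2) = \<bar>det (matrix L)\<bar> * sqrt (det (gram H)) / sqrt (det (gram G))"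
    by (simp add: real_sqrt_mult real_sqrt_divide)
  then show ?thesis by (simp add: nn prod_nonneg)
qed

section \<open>The norm of a covector\<close>

lemma alternating_form_cong: "alternating_form k \<alpha> \<Longrightarrow> (\<And>i. i < k \<Longrightarrow> v i = w i) \<Longrightarrow> \<alpha> v = \<alpha> w"
  and alternating_form_linear: "alternating_form k \<alpha> \<Longrightarrow> i < k \<Longrightarrow> linear (\<lambda>u. \<alpha> (v(i := u)))"
  and alternating_form_zero:
    "alternating_form k \<alpha> \<Longrightarrow> i < k \<Longrightarrow> j < k \<Longrightarrow> i \<noteq> j \<Longrightarrow> v i = v j \<Longrightarrow> \<alpha> v = 0"
  unfolding alternating_form_def by blast+

section \<open>Multilinear algebra of alternating forms\<close>

lemma alternating_form_compose_linear:
  assumes \<alpha>: "alternating_form k \<alpha>" and L: "linear L"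
  shows "alternating_form k (\<lambda>v. \<alpha> (\<lambda>j. L (v j)))"
  unfolding alternating_form_def
proof (intro conjI allI impI)
  show "\<alpha> (\<lambda>j. L (v j)) = \<alpha> (\<lambda>j. L (w j))" if "\<forall>i<k. v i = w i" for v w
    using that by (intro alternating_form_cong[OF \<alpha>]) auto
  show "linear (\<lambda>u. \<alpha> (\<lambda>j. L ((v(i := u)) j)))" if "i < k" for v i
  proof -
    have "(\<lambda>j. L ((v(i := u)) j)) = (\<lambda>j. L (v j))(i := L u)" for u by auto
    then show ?thesis
      using linear_compose[OF L alternating_form_linear[OF \<alpha> that, of "\<lambda>j. L (v j)"]] by (simp add: o_def)
  qed
  show "\<alpha> (\<lambda>j. L (v j)) = 0" if "i < k" "j < k" "i \<noteq> j \<and> v i = v j" for v i j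
    using that by (intro alternating_form_zero[OF \<alpha>, of i j]) auto
qed

lemma alternating_form_expand:
  fixes b :: "'m::finite \<Rightarrow> real ^ ('n::finite)"
  assumes \<alpha>: "alternating_form k \<alpha>"
  shows "\<alpha> (\<lambda>j. \<Sum>a\<in>UNIV. c j a *\<^sub>R b a) =
    (\<Sum>a\<in>{..<k} \<rightarrow>\<^sub>E UNIV. (\<Prod>j<k. c j (a j)) * \<alpha> (\<lambda>j. b (a j)))"
proof -
  \<comment> \<open>Only the first \<open>m\<close> slots are expanded and the others are kept at
    \<open>w\<close>. The induction needs \<open>w\<close> arbitrary, because the step stores the
    still unexpanded slot \<open>m\<close> in it.\<close>
  have "\<alpha> (\<lambda>j. if j < m then \<Sum>a\<in>UNIV. c j a *\<^sub>R b a else w j) =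
    (\<Sum>a\<in>{..<m} \<rightarrow>\<^sub>E UNIV. (\<Prod>j<m. c j (a j)) * \<alpha> (\<lambda>j. if j < m then b (a j) else w j))"
    if "m \<le> k" for m w
    using that
  proof (induction m arbitrary: w)
    case 0
    then show ?case by simp
  next
    case (Suc m)
    define w' where "w' = w(m := \<Sum>a\<in>UNIV. c m a *\<^sub>R b a)"
    define g where "g a x = (\<lambda>j. if j < Suc m then b ((a(m := x)) j) else w j)" for a x
    have lin: "\<alpha> (\<lambda>j. if j < m then b (a j) else w' j) = (\<Sum>x\<in>UNIV. c m x * \<alpha> (g a x))" for a
    proof -
      define v where "v = (\<lambda>j. if j < m then b (a j) else w j)"
      have 1: "linear (\<lambda>u. \<alpha> (v(m := u)))" using Suc.prems by (intro alternating_form_linear[OF \<alpha>]) auto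
      have "(\<lambda>j. if j < m then b (a j) else w' j) = v(m := \<Sum>a\<in>UNIV. c m a *\<^sub>R b a)"
        by (auto simp: v_def w'_def)
      moreover have "v(m := b x) = g a x" for x by (auto simp: v_def g_def less_Suc_eq)
      ultimately show ?thesis by (simp add: linear_sum[OF 1] linear_cmul[OF 1])
    qed
    have "(\<lambda>j. if j < Suc m then \<Sum>a\<in>UNIV. c j a *\<^sub>R b a else w j) =
        (\<lambda>j. if j < m then \<Sum>a\<in>UNIV. c j a *\<^sub>R b a else w' j)"
      by (auto simp: w'_def less_Suc_eq)
    then have "\<alpha> (\<lambda>j. if j < Suc m then \<Sum>a\<in>UNIV. c j a *\<^sub>R b a else w j) =
        (\<Sum>a\<in>{..<m} \<rightarrow>\<^sub>E UNIV. (\<Prod>j<m. c j (a j)) * (\<Sum>x\<in>UNIV. c m x * \<alpha> (g a x)))"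
      using Suc by (simp add: lin)
    also have "\<dots> = (\<Sum>(x, a)\<in>UNIV \<times> ({..<m} \<rightarrow>\<^sub>E UNIV). (\<Prod>j<m. c j (a j)) * (c m x * \<alpha> (g a x)))"
      by (subst sum.cartesian_product[symmetric], subst sum.swap) (simp add: sum_distrib_left)
    also have "\<dots> = (\<Sum>(x, a)\<in>UNIV \<times> ({..<m} \<rightarrow>\<^sub>E UNIV). 
        (\<Prod>j<Suc m. c j ((a(m := x)) j)) * \<alpha> (\<lambda>j. if j < Suc m then b ((a(m := x)) j) else w j))"
      by (intro sum.cong) (auto simp: g_def mult_ac)
    also have "\<dots> = (\<Sum>a\<in>{..<Suc m} \<rightarrow>\<^sub>E UNIV.
        (\<Prod>j<Suc m. c j (a j)) * \<alpha> (\<lambda>j. if j < Suc m then b (a j) else w j))"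
      unfolding lessThan_Suc PiE_insert_eq
      by (subst sum.reindex) 
        (use inj_combinator[of m "{..<m}" "\<lambda>_. UNIV"] in \<open>auto intro!: sum.cong simp: lessThan_Suc split_def\<close>)
    finally show ?case .
  qed
  from this[of k "\<lambda>_. 0"]
  have "\<alpha> (\<lambda>j. if j < k then \<Sum>a\<in>UNIV. c j a *\<^sub>R b a else 0) =
    (\<Sum>a\<in>{..<k} \<rightarrow>\<^sub>E UNIV. (\<Prod>j<k. c j (a j)) * \<alpha> (\<lambda>j. if j < k then b (a j) else 0))" by simp
  moreover have "\<alpha> (\<lambda>j. if j < k then \<Sum>a\<in>UNIV. c j a *\<^sub>R b a else 0) = \<alpha> (\<lambda>j. \<Sum>a\<in>UNIV. c j a *\<^sub>R b a)"
    by (intro alternating_form_cong[OF \<alpha>]) auto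
  moreover have "\<alpha> (\<lambda>j. if j < k then b (a j) else 0) = \<alpha> (\<lambda>j. b (a j))" for a
    by (intro alternating_form_cong[OF \<alpha>]) auto
  ultimately show ?thesis by simp
qed

lemma alternating_form_scale:
  assumes \<alpha>: "alternating_form k \<alpha>"
  shows "\<alpha> (\<lambda>j. c j *\<^sub>R v j) = (\<Prod>j<k. c j) * \<alpha> v"
proof -
  have "\<alpha> (\<lambda>j. if j < m then c j *\<^sub>R v j else v j) = (\<Prod>j<m. c j) * \<alpha> v" if "m \<le> k" for m
    using that
  proof (induction m)
    case 0
    then show ?case by simp
  next
    case (Suc m)
    define w where "w = (\<lambda>j. if j < m then c j *\<^sub>R v j else v j)"
    have 1: "linear (\<lambda>u. \<alpha> (w(m := u)))" using Suc.prems by (intro alternating_form_linear[OF \<alpha>]) auto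
    have "(\<lambda>j. if j < Suc m then c j *\<^sub>R v j else v j) = w(m := c m *\<^sub>R w m)"
      by (auto simp: w_def less_Suc_eq)
    then show ?case using Suc linear_cmul[OF 1, of "c m" "w m"] by (simp add: w_def[symmetric])
  qed
  from this[of k] have "\<alpha> (\<lambda>j. if j < k then c j *\<^sub>R v j else v j) = (\<Prod>j<k. c j) * \<alpha> v" by simp
  moreover have "\<alpha> (\<lambda>j. if j < k then c j *\<^sub>R v j else v j) = \<alpha> (\<lambda>j. c j *\<^sub>R v j)"
    by (intro alternating_form_cong[OF \<alpha>]) auto
  ultimately show ?thesis by simp
qed

text \<open>Polarisation: with the other slots fixed, evaluate at \<open>v i + v j\<close> in both
  slots \<open>i\<close> and \<open>j\<close>; the terms with equal entries vanish.\<close>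

lemma alternating_form_swap:
  assumes \<alpha>: "alternating_form k \<alpha>" and "i < k" "j < k" "i \<noteq> j"
  shows "\<alpha> (v \<circ> Transposition.transpose i j) = - \<alpha> v"
proof -
  define g where "g x y = \<alpha> (v(i := x, j := y))" for x y
  have g: "g x y = \<alpha> (v(j := y, i := x))" for x y
    using assms(4) by (simp add: g_def fun_upd_twist)
  have l1: "linear (\<lambda>x. g x y)" for y unfolding g by (rule alternating_form_linear[OF \<alpha> assms(2)])
  have l2: "linear (\<lambda>y. g x y)" for x unfolding g_def by (rule alternating_form_linear[OF \<alpha> assms(3)])
  have g0: "g x x = 0" for x
    unfolding g_def using assms by (intro alternating_form_zero[OF \<alpha>, of i j]) auto
  have "g (v i + v j) (v i + v j) = g (v i) (v i) + g (v i) (v j) + (g (v j) (v i) + g (v j) (v j))"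
    by (simp only: linear_add[OF l1] linear_add[OF l2])
  then have "g (v j) (v i) = - g (v i) (v j)" by (simp add: g0)
  moreover have "v(i := v j, j := v i) = v \<circ> Transposition.transpose i j"
    by (auto simp: Transposition.transpose_def fun_eq_iff)
  ultimately show ?thesis by (simp add: g_def)
qed

text \<open>A transposition only changes the sign, which the square removes; the norm involves
  squares only.\<close>

lemma alternating_form_permute:
  assumes \<alpha>: "alternating_form k \<alpha>" and "\<pi> permutes {..<k}"
  shows "(\<alpha> (v \<circ> \<pi>))\<^sup>2 = (\<alpha> v)\<^sup>2"
  using finite_lessThan[of k] assms(2)
proof (induction arbitrary: v rule: permutes_rev_induct)
  case id
  then show ?case by simp
next
  case (swap a b p)
  have "(\<alpha> (v \<circ> p \<circ> Transposition.transpose a b))\<^sup>2 = (\<alpha> (v \<circ> p))\<^sup>2"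
    using alternating_form_swap[OF \<alpha>, of a b "v \<circ> p"] swap by (cases "a = b") auto
  then show ?case using swap by (simp add: o_def)
qed

text \<open>An injective tuple amounts to its image together with the order in which it lists the
  image, measured against the increasing enumeration.\<close>

lemma bij_betw_injective_tuples:
  "bij_betw (\<lambda>(\<pi>, I). restrict (\<lambda>j. sorted_list_of_set I ! \<pi> j) {..<k})
     ({\<pi>. \<pi> permutes {..<k}} \<times> {I :: 'n::{finite,linorder} set. card I = k})
     {a \<in> {..<k} \<rightarrow>\<^sub>E UNIV. inj_on a {..<k}}"
proof -
  define F where "F = (\<lambda>(\<pi>, I :: 'n set). restrict (\<lambda>j. sorted_list_of_set I ! \<pi> j) {..<k})"
  have nth: "bij_betw ((!) (sorted_list_of_set I)) {..<k} I" if "card I = k" for I :: "'n set"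
    using that by (intro bij_betw_nth) auto
  have bF: "bij_betw (F (\<pi>, I)) {..<k} I" if "\<pi> permutes {..<k}" "card I = k" for \<pi> I
  proof -
    have "bij_betw ((!) (sorted_list_of_set I) \<circ> \<pi>) {..<k} I"
      using bij_betw_trans[OF permutes_imp_bij[OF that(1)] nth[OF that(2)]] .
    then show ?thesis by (rule bij_betw_cong[THEN iffD1, rotated]) (simp add: F_def)
  qed
  have inj: "(\<pi>, I) = (\<pi>', I')"
    if h: "\<pi> permutes {..<k}" "card I = k" "\<pi>' permutes {..<k}" "card I' = k" "F (\<pi>, I) = F (\<pi>', I')"
    for \<pi> I \<pi>' I'
  proof -
    have I: "I = I'" using bF[OF h(1,2)] bF[OF h(3,4)] h(5) by (simp add: bij_betw_def)
    have "\<pi> j = \<pi>' j" if "j < k" for j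
    proof -
      have "sorted_list_of_set I ! \<pi> j = sorted_list_of_set I ! \<pi>' j"
        using fun_cong[OF h(5), of j] that I by (simp add: F_def)
      moreover have "\<pi> j \<in> {..<k}" "\<pi>' j \<in> {..<k}"
        using permutes_in_image[OF h(1)] permutes_in_image[OF h(3)] that by auto
      ultimately show ?thesis using bij_betw_imp_inj_on[OF nth[OF h(2)]] by (auto dest: inj_onD)
    qed
    moreover have "\<pi> j = \<pi>' j" if "\<not> j < k" for j
      using that permutes_not_in[OF h(1), of j] permutes_not_in[OF h(3), of j] by simp
    ultimately have "\<pi> = \<pi>'" by blast
    then show ?thesis using I by simp
  qed
  have surj: "\<exists>\<pi> I. \<pi> permutes {..<k} \<and> card I = k \<and> F (\<pi>, I) = a"
    if a: "a \<in> {..<k} \<rightarrow>\<^sub>E UNIV" "inj_on a {..<k}" for a :: "nat \<Rightarrow> 'n"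
  proof -
    define I where "I = a ` {..<k}"
    have I: "card I = k" using card_image[OF a(2)] by (simp add: I_def)
    define h where "h = the_inv_into {..<k} ((!) (sorted_list_of_set I))"
    \<comment> \<open>\<open>h (a j)\<close> is the position of \<open>a j\<close> in the increasing
      list of the image; outside \<open>{..<k}\<close> a permutation of \<open>{..<k}\<close> must
      be the identity.\<close>
    define \<pi> where "\<pi> j = (if j < k then h (a j) else j)" for j
    have "bij_betw a {..<k} I" using a(2) by (simp add: bij_betw_def I_def)
    then have "bij_betw (h \<circ> a) {..<k} {..<k}"
      unfolding h_def by (rule bij_betw_trans) (rule bij_betw_the_inv_into[OF nth[OF I]])
    then have "bij_betw \<pi> {..<k} {..<k}"
      by (rule bij_betw_cong[THEN iffD1, rotated]) (simp add: \<pi>_def)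
    then have "\<pi> permutes {..<k}" by (rule bij_imp_permutes) (simp add: \<pi>_def)
    moreover have "F (\<pi>, I) = a"
    proof
      fix j show "F (\<pi>, I) j = a j"
      proof (cases "j < k")
        case True
        then have "a j \<in> I" by (simp add: I_def)
        then have "sorted_list_of_set I ! h (a j) = a j"
          unfolding h_def by (rule f_the_inv_into_f_bij_betw[OF nth[OF I]])
        then show ?thesis using True by (simp add: F_def \<pi>_def)
      next
        case False
        then show ?thesis using PiE_arb[OF a(1), of j] by (simp add: F_def)
      qed
    qed
    ultimately show ?thesis using I by blast
  qed
  have "bij_betw F ({\<pi>. \<pi> permutes {..<k}} \<times> {I. card I = k}) {a \<in> {..<k} \<rightarrow>\<^sub>E UNIV. inj_on a {..<k}}"
    unfolding bij_betw_def
  proof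
    show "inj_on F ({\<pi>. \<pi> permutes {..<k}} \<times> {I. card I = k})"
    proof (rule inj_onI)
      fix z z'
      assume z: "z \<in> {\<pi>. \<pi> permutes {..<k}} \<times> {I. card I = k}"
        "z' \<in> {\<pi>. \<pi> permutes {..<k}} \<times> {I. card I = k}" "F z = F z'"
      obtain \<pi> I \<pi>' I' where "z = (\<pi>, I)" "z' = (\<pi>', I')" by (cases z; cases z') blast
      with z show "z = z'" using inj[of \<pi> I \<pi>' I'] by blast
    qed
    show "F ` ({\<pi>. \<pi> permutes {..<k}} \<times> {I. card I = k}) = {a \<in> {..<k} \<rightarrow>\<^sub>E UNIV. inj_on a {..<k}}"
    proof (intro equalityI subsetI)
      fix a assume "a \<in> F ` ({\<pi>. \<pi> permutes {..<k}} \<times> {I. card I = k})"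
      then obtain \<pi> I where a: "\<pi> permutes {..<k}" "card I = k" "a = F (\<pi>, I)" by blast
      have "inj_on a {..<k}" using bF[OF a(1,2)] a(3) by (simp add: bij_betw_def)
      moreover have "a \<in> {..<k} \<rightarrow>\<^sub>E UNIV" unfolding a(3) F_def by simp
      ultimately show "a \<in> {a \<in> {..<k} \<rightarrow>\<^sub>E UNIV. inj_on a {..<k}}" by blast
    next
      fix a assume "a \<in> {a \<in> {..<k} \<rightarrow>\<^sub>E (UNIV :: 'n set). inj_on a {..<k}}"
      then obtain \<pi> I where "\<pi> permutes {..<k}" "card I = k" "F (\<pi>, I) = a" using surj[of a] by auto
      then show "a \<in> F ` ({\<pi>. \<pi> permutes {..<k}} \<times> {I. card I = k})" by force
    qed
  qed
  then show ?thesis unfolding F_def .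
qed

text \<open>Tuples with a repetition contribute 0, and each subset arises from \<open>fact k\<close>
  orderings with equal squares. The sum over all tuples is the one that factorises slot by slot, so
  frame independence is proved for it and then transferred to subsets.\<close>

lemma sum_tuples_eq_fact_sum_subsets:
  fixes e :: "'n::{finite,linorder} \<Rightarrow> real ^ ('m::finite)"
  assumes \<alpha>: "alternating_form k \<alpha>"
  shows "(\<Sum>a\<in>{..<k} \<rightarrow>\<^sub>E UNIV. (\<alpha> (\<lambda>j. e (a j)))\<^sup>2) =
    fact k * (\<Sum>I | card I = k. (\<alpha> (\<lambda>j. e (sorted_list_of_set I ! j)))\<^sup>2)"
proof -
  have fin: "finite ({..<k} \<rightarrow>\<^sub>E (UNIV :: 'n set))" by (intro finite_PiE) auto
  have "\<alpha> (\<lambda>j. e (a j)) = 0" if "\<not> inj_on a {..<k}" for a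
  proof -
    obtain i j where "i < k" "j < k" "i \<noteq> j" "a i = a j" using \<open>\<not> inj_on a {..<k}\<close> by (auto simp: inj_on_def)
    then show ?thesis by (intro alternating_form_zero[OF \<alpha>, of i j]) auto
  qed
  then have "(\<Sum>a\<in>{..<k} \<rightarrow>\<^sub>E UNIV. (\<alpha> (\<lambda>j. e (a j)))\<^sup>2) =
      (\<Sum>a\<in>{a \<in> {..<k} \<rightarrow>\<^sub>E UNIV. inj_on a {..<k}}. (\<alpha> (\<lambda>j. e (a j)))\<^sup>2)"
    by (intro sum.mono_neutral_right fin) auto
  also have "\<dots> = (\<Sum>(\<pi>, I)\<in>{\<pi>. \<pi> permutes {..<k}} \<times> {I. card I = k}.
      (\<alpha> (\<lambda>j. e (restrict (\<lambda>j. sorted_list_of_set I ! \<pi> j) {..<k} j)))\<^sup>2)"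
    by (subst sum.reindex_bij_betw[OF bij_betw_injective_tuples, symmetric]) (simp add: split_def)
  also have "\<dots> = (\<Sum>(\<pi>, I)\<in>{\<pi>. \<pi> permutes {..<k}} \<times> {I. card I = k}.
      (\<alpha> (\<lambda>j. e (sorted_list_of_set I ! j)))\<^sup>2)"
  proof -
    have "(\<alpha> (\<lambda>j. e (restrict (\<lambda>j. sorted_list_of_set I ! \<pi> j) {..<k} j)))\<^sup>2 =
        (\<alpha> (\<lambda>j. e (sorted_list_of_set I ! j)))\<^sup>2" if \<pi>: "\<pi> permutes {..<k}" for \<pi> and I :: "'n set"
    proof -
      have "\<alpha> (\<lambda>j. e (restrict (\<lambda>j. sorted_list_of_set I ! \<pi> j) {..<k} j)) =
          \<alpha> ((\<lambda>j. e (sorted_list_of_set I ! j)) \<circ> \<pi>)"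
        by (intro alternating_form_cong[OF \<alpha>]) auto
      then show ?thesis by (simp add: alternating_form_permute[OF \<alpha> \<pi>])
    qed
    then show ?thesis by (intro sum.cong) (auto simp del: restrict_apply)
  qed
  also have "\<dots> = fact k * (\<Sum>I | card I = k. (\<alpha> (\<lambda>j. e (sorted_list_of_set I ! j)))\<^sup>2)"
    by (simp add: sum.cartesian_product[symmetric] card_permutations[of "{..<k}" k])
  finally show ?thesis .
qed

text \<open>After expanding each frame vector in the standard basis, the sum over \<open>i\<close>
  becomes a product over the slots of sums over single frame vectors, and each factor is an entry of
  the inverse Gram matrix. The right-hand side no longer contains the frame.\<close>

lemma sum_tuples_orthonormal_frame:
  fixes G :: "real ^ ('n::finite) \<Rightarrow> real ^ 'n \<Rightarrow> real"
  assumes \<alpha>: "alternating_form k \<alpha>" and B: "bilinear G" and e: "orthonormal_frame G e"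
  shows "(\<Sum>i\<in>{..<k} \<rightarrow>\<^sub>E UNIV. (\<alpha> (\<lambda>j. e (i j)))\<^sup>2) =
    (\<Sum>a\<in>{..<k} \<rightarrow>\<^sub>E UNIV. \<Sum>b\<in>{..<k} \<rightarrow>\<^sub>E UNIV. (\<Prod>j<k. matrix_inv (gram G) $ a j $ b j) *
      (\<alpha> (\<lambda>j. axis (a j) 1) * \<alpha> (\<lambda>j. axis (b j) 1)))"
proof -
  have 1: "\<alpha> (\<lambda>j. e (i j)) = (\<Sum>a\<in>{..<k} \<rightarrow>\<^sub>E UNIV. (\<Prod>j<k. e (i j) $ a j) * \<alpha> (\<lambda>j. axis (a j) 1))" for i
  proof -
    have "e (i j) = (\<Sum>a\<in>UNIV. (e (i j) $ a) *\<^sub>R axis a 1)" for j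
      using basis_expansion[of "e (i j)"] by (simp add: scalar_mult_eq_scaleR)
    then show ?thesis
      using alternating_form_expand[OF \<alpha>, of "\<lambda>j a. e (i j) $ a" "\<lambda>a. axis a 1"] by simp
  qed
  have "(\<Sum>i\<in>{..<k} \<rightarrow>\<^sub>E UNIV. (\<alpha> (\<lambda>j. e (i j)))\<^sup>2) =
     (\<Sum>i\<in>{..<k} \<rightarrow>\<^sub>E UNIV. \<Sum>a\<in>{..<k} \<rightarrow>\<^sub>E UNIV. \<Sum>b\<in>{..<k} \<rightarrow>\<^sub>E UNIV.
       (\<Prod>j<k. e (i j) $ a j * e (i j) $ b j) * (\<alpha> (\<lambda>j. axis (a j) 1) * \<alpha> (\<lambda>j. axis (b j) 1)))"
    unfolding 1 power2_eq_square sum_product prod.distrib by (simp add: mult_ac)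
  also have "\<dots> = (\<Sum>a\<in>{..<k} \<rightarrow>\<^sub>E UNIV. \<Sum>b\<in>{..<k} \<rightarrow>\<^sub>E UNIV. \<Sum>i\<in>{..<k} \<rightarrow>\<^sub>E UNIV.
       (\<Prod>j<k. e (i j) $ a j * e (i j) $ b j) * (\<alpha> (\<lambda>j. axis (a j) 1) * \<alpha> (\<lambda>j. axis (b j) 1)))"
    by (subst sum.swap, rule sum.cong[OF refl], rule sum.swap)
  also have "\<dots> = (\<Sum>a\<in>{..<k} \<rightarrow>\<^sub>E UNIV. \<Sum>b\<in>{..<k} \<rightarrow>\<^sub>E UNIV.
       (\<Prod>j<k. \<Sum>i\<in>UNIV. e i $ a j * e i $ b j) * (\<alpha> (\<lambda>j. axis (a j) 1) * \<alpha> (\<lambda>j. axis (b j) 1)))"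
    by (simp add: sum_distrib_right prod_sum_PiE)
  finally show ?thesis by (simp add: matrix_inv_gram[OF B e])
qed

text \<open>Allows any convenient frame in place of the one chosen by \<open>SOME\<close>: times
  \<open>fact k\<close>, both sums equal the same expression in the inverse Gram matrix.\<close>

lemma covector_norm_frame:
  fixes G :: "real ^ ('n::{finite,wellorder}) \<Rightarrow> real ^ ('n::{finite,wellorder}) \<Rightarrow> real"
  assumes \<alpha>: "alternating_form k \<alpha>" and B: "bilinear G" and e: "orthonormal_frame G e"
  shows "covector_norm G k \<alpha> = sqrt (\<Sum>I | card I = k. (\<alpha> (\<lambda>j. e (sorted_list_of_set I ! j)))\<^sup>2)"
proof -
  define e' where "e' = (SOME e. orthonormal_frame G e)"
  have "orthonormal_frame G e'" unfolding e'_def using e by (rule someI[of "orthonormal_frame G"])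
  then have "fact k * (\<Sum>I | card I = k. (\<alpha> (\<lambda>j. e' (sorted_list_of_set I ! j)))\<^sup>2) =
      fact k * (\<Sum>I | card I = k. (\<alpha> (\<lambda>j. e (sorted_list_of_set I ! j)))\<^sup>2)"
    using sum_tuples_orthonormal_frame[OF \<alpha> B] e
    by (simp add: sum_tuples_eq_fact_sum_subsets[OF \<alpha>, symmetric])
  then show ?thesis by (simp add: covector_norm_def Let_def e'_def[symmetric])
qed

text \<open>The form of the norm used for measurability: the metric and the covector enter only
  through their coefficients in the standard basis.\<close>

lemma covector_norm_gram:
  fixes G :: "real ^ ('n::{finite,wellorder}) \<Rightarrow> real ^ ('n::{finite,wellorder}) \<Rightarrow> real"
  assumes \<alpha>: "alternating_form k \<alpha>" and G: "is_inner_product G"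
  shows "covector_norm G k \<alpha> = sqrt ((\<Sum>a\<in>{..<k} \<rightarrow>\<^sub>E UNIV. \<Sum>b\<in>{..<k} \<rightarrow>\<^sub>E UNIV.
    (\<Prod>j<k. matrix_inv (gram G) $ a j $ b j) * (\<alpha> (\<lambda>j. axis (a j) 1) * \<alpha> (\<lambda>j. axis (b j) 1))) / fact k)"
proof -
  note B = inner_product_bilinear[OF G]
  obtain e where e: "orthonormal_frame G e" using orthonormal_frame_exists[OF G] .
  show ?thesis
    unfolding covector_norm_frame[OF \<alpha> B e] sum_tuples_orthonormal_frame[OF \<alpha> B e, symmetric]
      sum_tuples_eq_fact_sum_subsets[OF \<alpha>] by simp
qed

text \<open>\<open>A\<close> carries frames of the pulled-back inner product to frames of
  \<open>G\<close>. It is applied with \<open>A\<close> the change from a chart of the atlas to the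
  chart chosen at the point.\<close>

lemma covector_norm_linear_image:
  fixes G :: "real ^ ('n::{finite,wellorder}) \<Rightarrow> real ^ ('n::{finite,wellorder}) \<Rightarrow> real"
    and A :: "real ^ ('n::{finite,wellorder}) \<Rightarrow> real ^ ('n::{finite,wellorder})"
  assumes \<alpha>: "alternating_form k \<alpha>" and G: "is_inner_product G" and A: "linear A" "inj A"
  shows "covector_norm (\<lambda>v w. G (A v) (A w)) k (\<lambda>v. \<alpha> (\<lambda>j. A (v j))) = covector_norm G k \<alpha>"
proof -
  note G' = inner_product_linear_image[OF G A]
  obtain e where e: "orthonormal_frame (\<lambda>v w. G (A v) (A w)) e" using orthonormal_frame_exists[OF G'] .
  then have e': "orthonormal_frame G (\<lambda>i. A (e i))" by (simp add: orthonormal_frame_def)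
  show ?thesis
    unfolding covector_norm_frame[OF alternating_form_compose_linear[OF \<alpha> A(1)] inner_product_bilinear[OF G'] e]
      covector_norm_frame[OF \<alpha> inner_product_bilinear[OF G] e'] ..
qed

lemma covector_norm_nonneg: "covector_norm G k \<alpha> \<ge> 0"
  by (simp add: covector_norm_def Let_def sum_nonneg)

text \<open>\<open>L\<close> maps the singular frame \<open>e\<close> to the multiples
  \<open>\<sigma> i\<close> of an \<open>H\<close>-orthonormal frame \<open>h\<close>, so the
  component on a subset \<open>I\<close> is scaled by the product of \<sigma> over \<open>I\<close>.
  This product is one of the nonnegative summands of the factor on the right.\<close>

lemma covector_norm_pullback_le:
  fixes G H :: "real ^ ('n::{finite,wellorder}) \<Rightarrow> real ^ ('n::{finite,wellorder}) \<Rightarrow> real"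
  assumes \<alpha>: "alternating_form k \<alpha>" and G: "is_inner_product G" and H: "is_inner_product H"
    and L: "linear L" "inj L" and \<sigma>: "singular_values G H L \<sigma>"
  shows "covector_norm G k (\<lambda>v. \<alpha> (\<lambda>j. L (v j))) \<le> (\<Sum>I | card I = k. \<Prod>i\<in>I. \<sigma> i) * covector_norm H k \<alpha>"
proof -
  note BG = inner_product_bilinear[OF G] and BH = inner_product_bilinear[OF H]
  define s where "s = (\<Sum>I | card I = k. \<Prod>i\<in>I. \<sigma> i)"
  obtain e where e: "orthonormal_frame G e" and \<sigma>e: "\<And>i v. H (L (e i)) (L v) = (\<sigma> i)\<^sup>2 * G (e i) v"
    and nn: "\<And>i. \<sigma> i \<ge> 0"
    using \<sigma> unfolding singular_values_def by blast
  have Ge: "G (e i) (e j) = (if i = j then 1 else 0)" for i j using e by (simp add: orthonormal_frame_def)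
  \<comment> \<open>Injectivity of \<open>L\<close> enters here: positive singular values allow the
    images of \<open>e\<close> to be normalised.\<close>
  have pos: "\<sigma> i > 0" for i
  proof -
    have "e i \<noteq> 0" using Ge[of i i] bilinear_lzero[OF BG] by auto
    then have "L (e i) \<noteq> 0" using L linear_injective_0 by blast
    then have "(\<sigma> i)\<^sup>2 > 0" using inner_product_pos[OF H, of "L (e i)"] by (simp add: \<sigma>e Ge)
    then show ?thesis using nn[of i] by (simp add: less_le)
  qed
  then have sne: "\<sigma> i \<noteq> 0" for i by (metis less_irrefl)
  define h where "h i = (1 / \<sigma> i) *\<^sub>R L (e i)" for i
  have h: "orthonormal_frame H h"
    unfolding orthonormal_frame_def h_def
    using sne by (simp add: bilinear_lmul[OF BH] bilinear_rmul[OF BH] \<sigma>e Ge power2_eq_square)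
  have Le: "L (e i) = \<sigma> i *\<^sub>R h i" for i by (simp add: h_def sne)
  have "(\<alpha> (\<lambda>j. L (e (sorted_list_of_set I ! j))))\<^sup>2 \<le> s\<^sup>2 * (\<alpha> (\<lambda>j. h (sorted_list_of_set I ! j)))\<^sup>2"
    if I: "card I = k" for I
  proof -
    have "(\<Prod>j<k. \<sigma> (sorted_list_of_set I ! j)) = (\<Prod>i\<in>I. \<sigma> i)"
      using I by (intro prod.reindex_bij_betw bij_betw_nth) auto
    then have "\<alpha> (\<lambda>j. L (e (sorted_list_of_set I ! j))) = (\<Prod>i\<in>I. \<sigma> i) * \<alpha> (\<lambda>j. h (sorted_list_of_set I ! j))"
      by (simp add: Le alternating_form_scale[OF \<alpha>])
    moreover have "(\<Prod>i\<in>I. \<sigma> i) \<le> s"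
      unfolding s_def using I nn by (intro member_le_sum) (auto intro: prod_nonneg)
    ultimately show ?thesis
      by (simp add: power_mult_distrib mult_right_mono power_mono nn prod_nonneg)
  qed
  then have "(\<Sum>I | card I = k. (\<alpha> (\<lambda>j. L (e (sorted_list_of_set I ! j))))\<^sup>2) \<le>
      s\<^sup>2 * (\<Sum>I | card I = k. (\<alpha> (\<lambda>j. h (sorted_list_of_set I ! j)))\<^sup>2)"
    unfolding sum_distrib_left by (intro sum_mono) auto
  then have "sqrt (\<Sum>I | card I = k. (\<alpha> (\<lambda>j. L (e (sorted_list_of_set I ! j))))\<^sup>2) \<le>
      sqrt (s\<^sup>2 * (\<Sum>I | card I = k. (\<alpha> (\<lambda>j. h (sorted_list_of_set I ! j)))\<^sup>2))"
    by (rule real_sqrt_le_mono)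
  moreover have "s \<ge> 0" unfolding s_def by (intro sum_nonneg prod_nonneg) (auto simp: nn)
  ultimately show ?thesis
    unfolding covector_norm_frame[OF alternating_form_compose_linear[OF \<alpha> L(1)] BG e]
      covector_norm_frame[OF \<alpha> BH h] s_def[symmetric]
    by (simp add: real_sqrt_mult)
qed

section \<open>Change of variables for the Lebesgue measure\<close>

text \<open>Extends \<open>has_measure_differentiable_image\<close>, which speaks of finite measures
  and gauge integrals, to values in \<open>ennreal\<close>: either side is finite exactly when the
  other is.\<close>

lemma emeasure_differentiable_image:
  fixes g :: "real ^ ('n::{finite,wellorder}) \<Rightarrow> real ^ ('n::{finite,wellorder})"
  assumes S: "S \<in> sets lebesgue" and der: "\<And>y. y \<in> S \<Longrightarrow> (g has_derivative g' y) (at y within S)"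
    and inj: "inj_on g S"
  shows "emeasure lebesgue (g ` S) = (\<integral>\<^sup>+y\<in>S. ennreal \<bar>det (matrix (g' y))\<bar> \<partial>lebesgue)"
proof -
  define F where "F y = (if y \<in> S then \<bar>det (matrix (g' y))\<bar> else 0)" for y
  have "F \<in> borel_measurable lebesgue"
    unfolding F_def using borel_measurable_det_Jacobian[OF S der]
    by (intro borel_measurable_if_I[OF _ S] borel_measurable_abs)
  then have iff: "(\<integral>\<^sup>+y. ennreal (F y) \<partial>lebesgue) = ennreal r \<longleftrightarrow> (F has_integral r) UNIV" if "0 \<le> r" for r
    using that by (subst has_integral_iff_nn_integral_lebesgue) (auto simp: F_def)
  have FS: "(F has_integral r) UNIV \<longleftrightarrow> g ` S \<in> lmeasurable \<and> measure lebesgue (g ` S) = r" for r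
    unfolding F_def has_integral_restrict_UNIV
    using has_measure_differentiable_image[OF S der inj, of r] by blast
  have "g differentiable_on S" unfolding differentiable_on_def using der differentiable_def by blast
  then have gS: "g ` S \<in> sets lebesgue" by (intro differentiable_image_in_sets_lebesgue[OF S]) auto
  have "emeasure lebesgue (g ` S) = (\<integral>\<^sup>+y. ennreal (F y) \<partial>lebesgue)"
  proof (cases "g ` S \<in> lmeasurable")
    case True
    then show ?thesis using FS[of "measure lebesgue (g ` S)"] iff[of "measure lebesgue (g ` S)"]
      by (simp add: emeasure_eq_measure2)
  next
    case False
    then have "emeasure lebesgue (g ` S) = \<infinity>" using gS unfolding fmeasurable_def infinity_ennreal_def
      using top.not_eq_extremum by blast
    moreover have "(\<integral>\<^sup>+y. ennreal (F y) \<partial>lebesgue) = \<infinity>"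
      using False FS iff by (cases "\<integral>\<^sup>+y. ennreal (F y) \<partial>lebesgue" rule: ennreal_cases) auto
    ultimately show ?thesis by simp
  qed
  also have "\<dots> = (\<integral>\<^sup>+y\<in>S. ennreal \<bar>det (matrix (g' y))\<bar> \<partial>lebesgue)"
    by (intro nn_integral_cong) (simp add: F_def)
  finally show ?thesis .
qed

text \<open>For Lebesgue instead of Borel sets in the target, continuity of \<open>g\<close> would
  not suffice. The preimage of a set is its image under the inverse \<open>h\<close>, and
  differentiable maps send Lebesgue sets to Lebesgue sets.\<close>

lemma measurable_lebesgue_on_differentiable_inverse:
  fixes g h :: "real ^ 'n::finite \<Rightarrow> real ^ 'n"
  assumes S: "S \<in> sets lebesgue" and T: "T \<in> sets lebesgue" and g: "g \<in> S \<rightarrow> T"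
    and h: "h differentiable_on T" "h \<in> T \<rightarrow> S" "\<And>y. y \<in> S \<Longrightarrow> h (g y) = y" "\<And>z. z \<in> T \<Longrightarrow> g (h z) = z"
  shows "g \<in> lebesgue_on S \<rightarrow>\<^sub>M lebesgue_on T"
proof (rule measurableI)
  show "g y \<in> space (lebesgue_on T)" if "y \<in> space (lebesgue_on S)" for y using g that by auto
  fix A assume "A \<in> sets (lebesgue_on T)"
  then have A: "A \<in> sets lebesgue" "A \<subseteq> T" using T by (auto simp: sets_restrict_space_iff)
  have "g -` A \<inter> S = h ` A" using h A(2) g by (auto simp: image_iff) metis
  moreover have "h ` A \<in> sets lebesgue"
    using differentiable_on_subset[OF h(1) A(2)] by (intro differentiable_image_in_sets_lebesgue[OF A(1)]) auto
  ultimately show "g -` A \<inter> space (lebesgue_on S) \<in> sets (lebesgue_on S)"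
    using S h(2) A(2) by (auto simp: sets_restrict_space_iff)
qed

lemma nn_integral_differentiable_image:
  fixes g h :: "real ^ ('n::{finite,wellorder}) \<Rightarrow> real ^ ('n::{finite,wellorder})"
  assumes S: "S \<in> sets lebesgue" and der: "\<And>y. y \<in> S \<Longrightarrow> (g has_derivative g' y) (at y within S)"
    and h: "h differentiable_on g ` S" "\<And>y. y \<in> S \<Longrightarrow> h (g y) = y"
    and F: "F \<in> borel_measurable (lebesgue_on (g ` S))"
  shows "(\<integral>\<^sup>+z\<in>g ` S. F z \<partial>lebesgue) = (\<integral>\<^sup>+y\<in>S. ennreal \<bar>det (matrix (g' y))\<bar> * F (g y) \<partial>lebesgue)"
proof -
  have inj: "inj_on g S" using h(2) by (metis inj_on_inverseI)
  have "g differentiable_on S" unfolding differentiable_on_def using der differentiable_def by blast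
  then have T: "g ` S \<in> sets lebesgue" by (intro differentiable_image_in_sets_lebesgue[OF S]) auto
  have meas: "g \<in> lebesgue_on S \<rightarrow>\<^sub>M lebesgue_on (g ` S)"
    using h by (intro measurable_lebesgue_on_differentiable_inverse[OF S T, of _ h]) auto
  define w where "w y = ennreal \<bar>det (matrix (g' y))\<bar>" for y
  have w: "w \<in> borel_measurable (lebesgue_on S)"
    unfolding w_def using borel_measurable_det_Jacobian[OF S der] by measurable
  have eq: "lebesgue_on (g ` S) = distr (density (lebesgue_on S) w) (lebesgue_on (g ` S)) g"
  proof (rule measure_eqI)
    fix A assume A': "A \<in> sets (lebesgue_on (g ` S))"
    then have A: "A \<in> sets lebesgue" "A \<subseteq> g ` S" using T by (auto simp: sets_restrict_space_iff)
    define E where "E = g -` A \<inter> S"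
    have "E \<in> sets (lebesgue_on S)" using measurable_sets[OF meas A'] by (simp add: E_def)
    then have E: "E \<in> sets lebesgue" "E \<subseteq> S" using S by (auto simp: sets_restrict_space_iff)
    have gE: "g ` E = A" using A(2) by (auto simp: E_def)
    have "emeasure lebesgue (g ` E) = (\<integral>\<^sup>+y\<in>E. w y \<partial>lebesgue)"
      unfolding w_def using der E inj
      by (intro emeasure_differentiable_image) (auto intro: has_derivative_subset inj_on_subset)
    also have "\<dots> = (\<integral>\<^sup>+y. w y * indicator E y \<partial>lebesgue_on S)"
      using S E(2) by (subst nn_integral_restrict_space) (auto intro!: nn_integral_cong simp: indicator_def)
    finally show "emeasure (lebesgue_on (g ` S)) A =
        emeasure (distr (density (lebesgue_on S) w) (lebesgue_on (g ` S)) g) A"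
      using A A' meas w S T \<open>E \<in> sets (lebesgue_on S)\<close>
      by (simp add: emeasure_distr emeasure_density gE emeasure_restrict_space flip: E_def)
  qed simp
  have "(\<integral>\<^sup>+z\<in>g ` S. F z \<partial>lebesgue) = (\<integral>\<^sup>+z. F z \<partial>lebesgue_on (g ` S))"
    using T by (subst nn_integral_restrict_space) auto
  also have "\<dots> = (\<integral>\<^sup>+z. F z \<partial>distr (density (lebesgue_on S) w) (lebesgue_on (g ` S)) g)"
    by (subst eq) simp
  also have "\<dots> = (\<integral>\<^sup>+y. w y * F (g y) \<partial>lebesgue_on S)"
    using meas F w by (subst nn_integral_distr; (subst nn_integral_density)?) (auto intro!: measurable_compose[OF meas F])
  also have "\<dots> = (\<integral>\<^sup>+y\<in>S. w y * F (g y) \<partial>lebesgue)"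
    using S by (subst nn_integral_restrict_space) auto
  finally show ?thesis unfolding w_def .
qed

section \<open>Countable gluing of measurability, and continuity of the inverse matrix\<close>

lemma measurable_lebesgue_on_UN:
  fixes A :: "nat \<Rightarrow> 'a::euclidean_space set"
  assumes "\<And>i. A i \<in> sets lebesgue" "\<And>i. f \<in> lebesgue_on (A i) \<rightarrow>\<^sub>M N"
  shows "f \<in> lebesgue_on (\<Union>i. A i) \<rightarrow>\<^sub>M N"
proof (rule measurable_piecewise_restrict[of "range A"])
  have U: "(\<Union>i. A i) \<in> sets lebesgue" using assms(1) by auto
  show "\<Omega> \<inter> space (lebesgue_on (\<Union>i. A i)) \<in> sets (lebesgue_on (\<Union>i. A i))" if "\<Omega> \<in> range A" for \<Omega>
    using that assms(1) U by (auto simp: sets_restrict_space_iff)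
  show "f \<in> measurable (restrict_space (lebesgue_on (\<Union>i. A i)) \<Omega>) N" if "\<Omega> \<in> range A" for \<Omega>
  proof -
    obtain i where i: "\<Omega> = A i" using \<open>\<Omega> \<in> range A\<close> by blast
    have "(\<Union>i. A i) \<inter> A i = A i" by blast
    then have "restrict_space (lebesgue_on (\<Union>i. A i)) \<Omega> = lebesgue_on (A i)"
      by (simp add: i restrict_restrict_space assms(1) U)
    then show ?thesis using assms(2)[of i] by simp
  qed
qed auto

text \<open>Cramer's rule for the columns of the inverse. It writes each entry as a quotient of
  determinants, hence as a continuous function of the matrix.\<close>

lemma matrix_inv_nth:
  fixes A :: "real ^ ('n::finite) ^ 'n"
  assumes "det A \<noteq> 0"
  shows "matrix_inv A $ a $ b = det (\<chi> i j. if j = a then axis b 1 $ i else A $ i $ j) / det A"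
proof -
  have "invertible A" using assms invertible_det_nz by blast
  then have "A ** matrix_inv A = mat 1"
    unfolding matrix_inv_def invertible_def by (auto intro: someI2_ex)
  then have "A *v (matrix_inv A *v axis b 1) = axis b 1"
    by (simp add: matrix_vector_mul_assoc)
  then have "matrix_inv A *v axis b 1 =
      (\<chi> k. det (\<chi> i j. if j = k then axis b 1 $ i else A $ i $ j) / det A)"
    using cramer[OF assms] by blast
  then have "(matrix_inv A *v axis b 1) $ a = det (\<chi> i j. if j = a then axis b 1 $ i else A $ i $ j) / det A"
    by simp
  then show ?thesis by (simp add: matrix_vector_mult_basis column_def)
qed

lemma continuous_on_det:
  fixes A :: "'a::topological_space \<Rightarrow> real ^ ('n::finite) ^ 'n"
  assumes "\<And>i j. continuous_on S (\<lambda>x. A x $ i $ j)"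
  shows "continuous_on S (\<lambda>x. det (A x))"
  unfolding det_def by (intro continuous_intros assms)

lemma continuous_on_matrix_inv_nth:
  fixes A :: "'a::topological_space \<Rightarrow> real ^ ('n::finite) ^ 'n"
  assumes A: "\<And>i j. continuous_on S (\<lambda>x. A x $ i $ j)" and "\<And>x. x \<in> S \<Longrightarrow> det (A x) \<noteq> 0"
  shows "continuous_on S (\<lambda>x. matrix_inv (A x) $ a $ b)"
proof -
  have "continuous_on S (\<lambda>x. (if j = a then axis b 1 $ i else A x $ i $ j) :: real)" for i j
    using A by (cases "j = a") auto
  then have "continuous_on S (\<lambda>x. det (\<chi> i j. if j = a then axis b 1 $ i else A x $ i $ j) / det (A x))"
    using assms by (intro continuous_on_divide continuous_on_det) auto
  then show ?thesis
    using assms(2) by (subst continuous_on_cong[OF refl matrix_inv_nth]) auto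
qed

section \<open>Calculus in charts\<close>

context
  fixes M :: "('a::{t2_space,second_countable_topology}, 'n::finite) riem"
  assumes M: "oriented_riemannian_manifold M"
begin

lemma atlas_chart:
  assumes "c \<in> atlas M"
  shows open_chart_dom: "open (chart_dom c)" and open_chart_im: "open (chart_im c)"
    and chart_homeomorphism: "homeomorphism (chart_dom c) (chart_im c) (coord c) (param c)"
  using assms M by (auto simp: oriented_riemannian_manifold_def oriented_smooth_atlas_def)

lemma param_coord: "c \<in> atlas M \<Longrightarrow> x \<in> chart_dom c \<Longrightarrow> param c (coord c x) = x"
  and coord_param: "c \<in> atlas M \<Longrightarrow> y \<in> chart_im c \<Longrightarrow> coord c (param c y) = y"
  and param_in_chart_dom: "c \<in> atlas M \<Longrightarrow> y \<in> chart_im c \<Longrightarrow> param c y \<in> chart_dom c"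
  using homeomorphism_apply1[OF chart_homeomorphism] homeomorphism_apply2[OF chart_homeomorphism]
    homeomorphism_image2[OF chart_homeomorphism] by blast+

lemma UN_chart_dom: "(\<Union>c\<in>atlas M. chart_dom c) = UNIV"
  using M by (auto simp: oriented_riemannian_manifold_def oriented_smooth_atlas_def)

lemma chart_at: "chart_at M x \<in> atlas M" "x \<in> chart_dom (chart_at M x)"
proof -
  have "\<exists>c. c \<in> atlas M \<and> x \<in> chart_dom c" using UN_chart_dom by blast
  then have "chart_at M x \<in> atlas M \<and> x \<in> chart_dom (chart_at M x)"
    unfolding chart_at_def by (rule someI_ex)
  then show "chart_at M x \<in> atlas M" "x \<in> chart_dom (chart_at M x)" by auto
qed

lemma metric_inner_product: "is_inner_product (metric M x)"
  using M by (auto simp: oriented_riemannian_manifold_def)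

lemma open_coord_image:
  assumes c: "c \<in> atlas M" and "open S"
  shows "open (coord c ` (chart_dom c \<inter> S))"
proof -
  have "openin (top_of_set (chart_im c)) (coord c ` (chart_dom c \<inter> S))"
    using assms by (intro homeomorphism_imp_open_map[OF chart_homeomorphism]) auto
  then show ?thesis using open_chart_im[OF c] openin_open_trans by blast
qed

text \<open>This is the smoothness of the transition maps. It lets coordinate changes be treated as
  the case \<open>f = id\<close> of results on smooth maps.\<close>

lemma smooth_map_id: "smooth_map M M id"
proof -
  have "smooth_on (coord c ` (chart_dom c \<inter> chart_dom d)) (coord d \<circ> param c)"
    if "c \<in> atlas M" "d \<in> atlas M" for c d
    using M that unfolding oriented_riemannian_manifold_def oriented_smooth_atlas_def by blast
  then show ?thesis by (simp add: smooth_map_def)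
qed

end

lemma smooth_on_differentiable: "smooth_on S f \<Longrightarrow> x \<in> S \<Longrightarrow> f differentiable (at x)"
  and smooth_on_continuous_frechet:
    "smooth_on S f \<Longrightarrow> continuous_on S (\<lambda>x. frechet_derivative f (at x) v)"
  and smooth_on_continuous: "smooth_on S f \<Longrightarrow> continuous_on S f"
proof -
  assume f: "smooth_on S f"
  have "Ck_on S (Suc 0) f" "Ck_on S 0 f" using f unfolding smooth_on_def by blast+
  then show "x \<in> S \<Longrightarrow> f differentiable (at x)" "continuous_on S (\<lambda>x. frechet_derivative f (at x) v)"
    "continuous_on S f" by auto
qed

text \<open>A common generalisation of \<open>coord_vec\<close> (the map is \<open>id\<close>) and
  \<open>differential\<close> (both charts are the chosen ones), so that a single chain rule serves
  both.\<close>

definition chart_deriv ::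
    "('b, 'n) chart \<Rightarrow> ('a \<Rightarrow> 'b) \<Rightarrow> ('a, 'n) chart \<Rightarrow> 'a \<Rightarrow> real ^ 'n \<Rightarrow> real ^ ('n::finite)" where
  "chart_deriv d f c x = frechet_derivative (coord d \<circ> f \<circ> param c) (at (coord c x))"

lemma coord_vec_eq: "coord_vec M c x = chart_deriv (chart_at M x) id c x"
  by (simp add: fun_eq_iff coord_vec_def chart_deriv_def)

lemma differential_eq: "differential M N f x = chart_deriv (chart_at N (f x)) f (chart_at M x) x"
  by (simp add: differential_def chart_deriv_def)

lemma chart_rep_has_derivative:
  assumes "smooth_map M N f" "c \<in> atlas M" "d \<in> atlas N" "x \<in> chart_dom c" "f x \<in> chart_dom d"
  shows "((coord d \<circ> f \<circ> param c) has_derivative chart_deriv d f c x) (at (coord c x))"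
proof -
  have "smooth_on (coord c ` (chart_dom c \<inter> f -` chart_dom d)) (coord d \<circ> f \<circ> param c)"
    using assms by (auto simp: smooth_map_def)
  then have "(coord d \<circ> f \<circ> param c) differentiable (at (coord c x))"
    by (rule smooth_on_differentiable) (use assms in auto)
  then show ?thesis unfolding chart_deriv_def by (simp add: frechet_derivative_works[symmetric])
qed

lemma linear_chart_deriv:
  assumes "smooth_map M N f" "c \<in> atlas M" "d \<in> atlas N" "x \<in> chart_dom c" "f x \<in> chart_dom d"
  shows "linear (chart_deriv d f c x)"
  by (rule has_derivative_linear[OF chart_rep_has_derivative[OF assms]])

text \<open>The chain rule in coordinates. Since \<open>param d\<close> inverts
  \<open>coord d\<close> only on the domain of \<open>d\<close>, the two expressions are compared on
  the part of the chart that \<open>f\<close> maps into this domain; by continuity it is an open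
  neighbourhood.\<close>

lemma chart_deriv_comp:
  fixes M :: "('a::{t2_space,second_countable_topology}, 'n::finite) riem"
    and N :: "('b::{t2_space,second_countable_topology}, 'n) riem"
  assumes M: "oriented_riemannian_manifold M" and N: "oriented_riemannian_manifold N"
    and f: "smooth_map M N f" and g: "smooth_map N P g"
    and c: "c \<in> atlas M" "x \<in> chart_dom c" and d: "d \<in> atlas N" "f x \<in> chart_dom d"
    and e: "e \<in> atlas P" "g (f x) \<in> chart_dom e"
  shows "chart_deriv e (g \<circ> f) c x = chart_deriv e g d (f x) \<circ> chart_deriv d f c x"
proof -
  have 1: "((coord d \<circ> f \<circ> param c) has_derivative chart_deriv d f c x) (at (coord c x))"
    using chart_rep_has_derivative[OF f c(1) d(1) c(2) d(2)] .
  have "(coord d \<circ> f \<circ> param c) (coord c x) = coord d (f x)"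
    using param_coord[OF M c] by simp
  then have "((coord e \<circ> g \<circ> param d) has_derivative chart_deriv e g d (f x))
      (at ((coord d \<circ> f \<circ> param c) (coord c x)))"
    using chart_rep_has_derivative[OF g d(1) e(1) d(2) e(2)] by simp
  then have 2: "((coord e \<circ> g \<circ> param d \<circ> (coord d \<circ> f \<circ> param c)) has_derivative
      chart_deriv e g d (f x) \<circ> chart_deriv d f c x) (at (coord c x))"
    using diff_chain_at[OF 1] by (simp add: o_assoc)
  have "continuous_on UNIV f" using f by (simp add: smooth_map_def)
  then have "open (f -` chart_dom d)" using open_chart_dom[OF N d(1)] by (simp add: open_vimage)
  then have op: "open (coord c ` (chart_dom c \<inter> f -` chart_dom d))" by (rule open_coord_image[OF M c(1)])
  have "((coord e \<circ> (g \<circ> f) \<circ> param c) has_derivative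
      chart_deriv e g d (f x) \<circ> chart_deriv d f c x) (at (coord c x))"
  proof (rule has_derivative_transform_within_open[OF 2 op])
    show "coord c x \<in> coord c ` (chart_dom c \<inter> f -` chart_dom d)" using c d by blast
    fix y assume "y \<in> coord c ` (chart_dom c \<inter> f -` chart_dom d)"
    then obtain z where "y = coord c z" "z \<in> chart_dom c" "f z \<in> chart_dom d" by blast
    then show "(coord e \<circ> g \<circ> param d \<circ> (coord d \<circ> f \<circ> param c)) y = (coord e \<circ> (g \<circ> f) \<circ> param c) y"
      using param_coord[OF M c(1)] param_coord[OF N d(1)] by simp
  qed
  then show ?thesis
    unfolding chart_deriv_def[of e "g \<circ> f"] by (rule frechet_derivative_at[symmetric])
qed

lemma chart_deriv_id:
  fixes M :: "('a::{t2_space,second_countable_topology}, 'n::finite) riem"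
  assumes M: "oriented_riemannian_manifold M" and c: "c \<in> atlas M" "x \<in> chart_dom c"
  shows "chart_deriv c id c x = id"
proof -
  have "((coord c \<circ> id \<circ> param c) has_derivative id) (at (coord c x))"
  proof (rule has_derivative_transform_within_open[OF has_derivative_id open_chart_im[OF M c(1)]])
    show "coord c x \<in> chart_im c" using c by blast
    fix y assume "y \<in> chart_im c"
    then show "id y = (coord c \<circ> id \<circ> param c) y" using coord_param[OF M c(1)] by simp
  qed
  then show ?thesis unfolding chart_deriv_def by (rule frechet_derivative_at[symmetric])
qed

text \<open>Both sides are the derivative of \<open>f\<close> from the chart \<open>c\<close> to the
  chosen chart at \<open>f x\<close>: once factored as \<open>f \<circ> id\<close> through the
  chosen chart at \<open>x\<close>, once as \<open>id \<circ> f\<close> through \<open>d\<close>.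
  This is how the arbitrary chart choice is traded for charts of the atlas.\<close>

lemma differential_coord_vec:
  fixes M :: "('a::{t2_space,second_countable_topology}, 'n::finite) riem"
    and N :: "('b::{t2_space,second_countable_topology}, 'n) riem"
  assumes M: "oriented_riemannian_manifold M" and N: "oriented_riemannian_manifold N"
    and f: "smooth_map M N f"
    and c: "c \<in> atlas M" "x \<in> chart_dom c" and d: "d \<in> atlas N" "f x \<in> chart_dom d"
  shows "differential M N f x (coord_vec M c x v) = coord_vec N d (f x) (chart_deriv d f c x v)"
proof -
  note cM = chart_at[OF M, of x] and cN = chart_at[OF N, of "f x"]
  have "chart_deriv (chart_at N (f x)) (f \<circ> id) c x = chart_deriv (chart_at N (f x)) f (chart_at M x) (id x)
      \<circ> chart_deriv (chart_at M x) id c x"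
    using cM cN by (intro chart_deriv_comp[OF M M smooth_map_id[OF M] f c, where d = "chart_at M x"]) auto
  moreover have "chart_deriv (chart_at N (f x)) (id \<circ> f) c x = chart_deriv (chart_at N (f x)) id d (f x)
      \<circ> chart_deriv d f c x"
    using cN by (intro chart_deriv_comp[OF M N f smooth_map_id[OF N] c d]) auto
  ultimately show ?thesis by (simp add: coord_vec_eq differential_eq fun_eq_iff)
qed

text \<open>Besides \<open>f\<close>, the locale is instantiated with \<open>id\<close>, to compare
  charts of one manifold, and with \<open>inv f\<close>.\<close>

locale riemannian_diffeo =
  fixes M :: "('a::{t2_space,second_countable_topology}, 'n::{finite,wellorder}) riem"
    and N :: "('b::{t2_space,second_countable_topology}, 'n) riem"
    and f :: "'a \<Rightarrow> 'b"
  assumes M: "oriented_riemannian_manifold M" and N: "oriented_riemannian_manifold N"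
    and f: "diffeomorphism M N f"
begin

lemma smooth_f: "smooth_map M N f" and smooth_inv: "smooth_map N M (inv f)" and bij_f: "bij f"
  using f by (auto simp: diffeomorphism_def)

lemma inv_f_f [simp]: "inv f (f x) = x" and f_inv_f [simp]: "f (inv f z) = z"
  using bij_f by (simp_all add: bij_is_inj bij_is_surj surj_f_inv_f)

lemma chart_deriv_inverse:
  assumes c: "c \<in> atlas M" "x \<in> chart_dom c" and d: "d \<in> atlas N" "f x \<in> chart_dom d"
  shows "chart_deriv c (inv f) d (f x) \<circ> chart_deriv d f c x = id"
proof -
  have "chart_deriv c (inv f) d (f x) \<circ> chart_deriv d f c x = chart_deriv c (inv f \<circ> f) c x"
    using c by (intro chart_deriv_comp[OF M N smooth_f smooth_inv c d, symmetric]) auto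
  also have "inv f \<circ> f = id" using bij_f by (simp add: bij_is_inj)
  finally show ?thesis unfolding chart_deriv_id[OF M c] .
qed

lemma inj_chart_deriv:
  assumes c: "c \<in> atlas M" "x \<in> chart_dom c" and d: "d \<in> atlas N" "f x \<in> chart_dom d"
  shows "inj (chart_deriv d f c x)"
  using chart_deriv_inverse[OF assms]
  by (intro inj_on_inverseI[where g = "chart_deriv c (inv f) d (f x)"]) (simp add: fun_eq_iff)

lemma linear_chart_deriv_f:
  assumes c: "c \<in> atlas M" "x \<in> chart_dom c" and d: "d \<in> atlas N" "f x \<in> chart_dom d"
  shows "linear (chart_deriv d f c x)"
  using assms by (intro linear_chart_deriv[OF smooth_f])

lemma linear_differential: "linear (differential M N f x)"
  and inj_differential: "inj (differential M N f x)"
  unfolding differential_eq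
  by (rule linear_chart_deriv_f[OF chart_at[OF M] chart_at[OF N]], rule inj_chart_deriv[OF chart_at[OF M] chart_at[OF N]])

end

lemma diffeomorphism_id: "oriented_riemannian_manifold M \<Longrightarrow> diffeomorphism M M id"
  by (simp only: diffeomorphism_def inv_id smooth_map_id bij_id simp_thms)

lemma riemannian_diffeo_id: "oriented_riemannian_manifold M \<Longrightarrow> riemannian_diffeo M M id"
  by (simp add: riemannian_diffeo_def diffeomorphism_id)

section \<open>Metric and volume density in a chart\<close>

lemma linear_coord_vec:
  assumes "oriented_riemannian_manifold M" "c \<in> atlas M" "x \<in> chart_dom c"
  shows "linear (coord_vec M c x)"
  unfolding coord_vec_eq
  using assms chart_at[OF assms(1)] by (intro linear_chart_deriv[OF smooth_map_id]) auto

lemma inj_coord_vec: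
  fixes M :: "('a::{t2_space,second_countable_topology}, 'n::{finite,wellorder}) riem"
  assumes "oriented_riemannian_manifold M" "c \<in> atlas M" "x \<in> chart_dom c"
  shows "inj (coord_vec M c x)"
  unfolding coord_vec_eq
  using assms chart_at[OF assms(1)]
  by (intro riemannian_diffeo.inj_chart_deriv[OF riemannian_diffeo_id[OF assms(1)]]) auto

definition chart_metric ::
    "('a, 'n::finite) riem \<Rightarrow> ('a, 'n) chart \<Rightarrow> 'a \<Rightarrow> real ^ 'n \<Rightarrow> real ^ 'n \<Rightarrow> real" where
  "chart_metric M c x u v = metric M x (coord_vec M c x u) (coord_vec M c x v)"

lemma chart_metric_inner_product:
  fixes M :: "('a::{t2_space,second_countable_topology}, 'n::{finite,wellorder}) riem"
  assumes "oriented_riemannian_manifold M" "c \<in> atlas M" "x \<in> chart_dom c"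
  shows "is_inner_product (chart_metric M c x)"
  unfolding chart_metric_def
  by (rule inner_product_linear_image[OF metric_inner_product[OF assms(1)] linear_coord_vec[OF assms] inj_coord_vec[OF assms]])

lemma volume_density_eq: "volume_density M c y = sqrt (det (gram (chart_metric M c (param c y))))"
  by (simp add: volume_density_def gram_def chart_metric_def Let_def)

text \<open>Separates the determinant of the coordinate change, which depends on \<open>c\<close>,
  from a factor that depends only on the point.\<close>

lemma volume_density_coord:
  assumes "oriented_riemannian_manifold M" "c \<in> atlas M" "x \<in> chart_dom c"
  shows "volume_density M c (coord c x) = \<bar>det (matrix (coord_vec M c x))\<bar> * sqrt (det (gram (metric M x)))"
proof -
  have "gram (chart_metric M c x) =
    transpose (matrix (coord_vec M c x)) ** gram (metric M x) ** matrix (coord_vec M c x)"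
    unfolding chart_metric_def
    by (rule gram_linear_image[OF inner_product_bilinear[OF metric_inner_product[OF assms(1)]] linear_coord_vec[OF assms]])
  then show ?thesis
    by (simp add: volume_density_eq param_coord[OF assms] det_mul det_transpose real_sqrt_mult power2_eq_square[symmetric]
        mult.commute mult.left_commute)
qed

lemma volume_density_pos:
  fixes M :: "('a::{t2_space,second_countable_topology}, 'n::{finite,wellorder}) riem"
  assumes "oriented_riemannian_manifold M" "c \<in> atlas M" "y \<in> chart_im c"
  shows "volume_density M c y > 0"
  unfolding volume_density_eq
  using det_gram_pos[OF chart_metric_inner_product[OF assms(1,2) param_in_chart_dom[OF assms]]] by simp

lemma det_nonzero_linear:
  fixes L :: "real ^ 'm::finite \<Rightarrow> real ^ 'm"
  shows "linear L \<Longrightarrow> inj L \<Longrightarrow> det (matrix L) \<noteq> 0"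
  using det_nz_iff_inj[of L] by simp

section \<open>The Jacobian and its expression in charts\<close>

context riemannian_diffeo
begin

text \<open>\<open>UNIV\<close> is the only subset of full cardinality, so the Jacobian is the
  product of all singular values, which has a formula by determinants.\<close>

lemma jacobian_eq:
  "jacobian M N f x = \<bar>det (matrix (differential M N f x))\<bar> * sqrt (det (gram (metric N (f x))))
     / sqrt (det (gram (metric M x)))"
proof -
  define \<sigma> where "\<sigma> = (SOME \<sigma>. singular_values (metric M x) (metric N (f x)) (differential M N f x) \<sigma>)"
  have "\<exists>\<sigma>. singular_values (metric M x) (metric N (f x)) (differential M N f x) \<sigma>"
    using singular_values_exist[OF metric_inner_product[OF M] metric_inner_product[OF N] linear_differential] by blast
  then have \<sigma>: "singular_values (metric M x) (metric N (f x)) (differential M N f x) \<sigma>"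
    unfolding \<sigma>_def by (rule someI_ex)
  have "{I. card I = CARD('n)} = {UNIV :: 'n set}"
    using card_subset_eq[of "UNIV :: 'n set"] by auto
  then have "jacobian M N f x = (\<Prod>i\<in>UNIV. \<sigma> i)"
    by (simp add: jacobian_def sigma_def \<sigma>_def[symmetric])
  also have "\<dots> = \<bar>det (matrix (differential M N f x))\<bar> * sqrt (det (gram (metric N (f x))))
     / sqrt (det (gram (metric M x)))"
    by (rule prod_singular_values[OF metric_inner_product[OF M] metric_inner_product[OF N] linear_differential \<sigma>])
  finally show ?thesis .
qed

lemma jacobian_pos: "jacobian M N f x > 0"
  unfolding jacobian_eq
  using det_nonzero_linear[OF linear_differential inj_differential, of x]
    det_gram_pos[OF metric_inner_product[OF M], of x] det_gram_pos[OF metric_inner_product[OF N], of "f x"]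
  by simp

text \<open>Taking determinants in \<open>differential_coord_vec\<close>: the factors coming from
  the chosen charts cancel or are absorbed into the densities, and the usual transformation rule for
  densities remains.\<close>

lemma jacobian_volume_density:
  assumes c: "c \<in> atlas M" "x \<in> chart_dom c" and d: "d \<in> atlas N" "f x \<in> chart_dom d"
  shows "jacobian M N f x * volume_density M c (coord c x) =
    \<bar>det (matrix (chart_deriv d f c x))\<bar> * volume_density N d (coord d (f x))"
proof -
  have "differential M N f x \<circ> coord_vec M c x = coord_vec N d (f x) \<circ> chart_deriv d f c x"
    using differential_coord_vec[OF M N smooth_f c d] by (simp add: fun_eq_iff)
  then have "matrix (differential M N f x) ** matrix (coord_vec M c x) =
      matrix (coord_vec N d (f x)) ** matrix (chart_deriv d f c x)"
    using linear_differential linear_coord_vec[OF M c] linear_coord_vec[OF N d] linear_chart_deriv_f[OF c d]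
    by (simp flip: matrix_compose)
  then have "det (matrix (differential M N f x)) * det (matrix (coord_vec M c x)) =
      det (matrix (coord_vec N d (f x))) * det (matrix (chart_deriv d f c x))"
    by (metis det_mul)
  then have *: "\<bar>det (matrix (differential M N f x))\<bar> * \<bar>det (matrix (coord_vec M c x))\<bar> =
      \<bar>det (matrix (coord_vec N d (f x)))\<bar> * \<bar>det (matrix (chart_deriv d f c x))\<bar>"
    by (metis abs_mult)
  have "jacobian M N f x * volume_density M c (coord c x) =
      (\<bar>det (matrix (differential M N f x))\<bar> * \<bar>det (matrix (coord_vec M c x))\<bar>) * sqrt (det (gram (metric N (f x))))"
    using det_gram_pos[OF metric_inner_product[OF M], of x]
    by (simp add: jacobian_eq volume_density_coord[OF M c])
  then show ?thesis unfolding * by (simp add: volume_density_coord[OF N d])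
qed

end

text \<open>Source and target use the same chosen chart, so the differential is the identity. This
  specialises the change of variables for \<open>id\<close> to the consistency of the
  volume.\<close>

lemma jacobian_id:
  fixes M :: "('a::{t2_space,second_countable_topology}, 'n::{finite,wellorder}) riem"
  assumes "oriented_riemannian_manifold M"
  shows "jacobian M M id x = 1"
proof -
  interpret riemannian_diffeo M M id by (rule riemannian_diffeo_id[OF assms])
  have "differential M M id x = id"
    using chart_deriv_id[OF assms chart_at[OF assms], of x] by (simp add: differential_eq)
  then show ?thesis using det_gram_pos[OF metric_inner_product[OF assms], of x]
    by (simp add: jacobian_eq matrix_id_mat_1)
qed

section \<open>The Riemannian volume\<close>

lemma suminf_swap_ennreal:
  fixes e :: "nat \<Rightarrow> nat \<Rightarrow> ennreal"
  shows "(\<Sum>i. \<Sum>j. e i j) = (\<Sum>j. \<Sum>i. e i j)"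
proof -
  have "(\<Sum>i. \<Sum>j. e i j) = (\<integral>\<^sup>+i. (\<Sum>j. e i j) \<partial>count_space UNIV)"
    by (simp add: nn_integral_count_space_nat)
  also have "\<dots> = (\<Sum>j. \<integral>\<^sup>+i. e i j \<partial>count_space UNIV)" by (rule nn_integral_suminf) simp
  finally show ?thesis by (simp add: nn_integral_count_space_nat)
qed

text \<open>The volume of \<open>chart_dom c\<close> carried to coordinates. It lives on Lebesgue
  sets because \<open>measurable_sets\<close> does.\<close>

definition chart_measure :: "('a, 'n::finite) riem \<Rightarrow> ('a, 'n) chart \<Rightarrow> (real ^ 'n) measure" where
  "chart_measure M c = density (lebesgue_on (chart_im c)) (\<lambda>y. ennreal (volume_density M c y))"

lemma space_chart_measure [simp]: "space (chart_measure M c) = chart_im c"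
  and sets_chart_measure: "sets (chart_measure M c) = sets (lebesgue_on (chart_im c))"
  by (simp_all add: chart_measure_def)

section \<open>Measurable sets and countable covers by charts\<close>

context
  fixes M :: "('a::{t2_space,second_countable_topology}, 'n::finite) riem"
  assumes M: "oriented_riemannian_manifold M"
begin

lemma coord_image_eq_vimage:
  "c \<in> atlas M \<Longrightarrow> coord c ` (S \<inter> chart_dom c) = param c -` S \<inter> chart_im c"
  using param_coord[OF M] by auto

lemma chart_im_lebesgue [simp]: "c \<in> atlas M \<Longrightarrow> chart_im c \<in> sets lebesgue"
  using open_chart_im[OF M] by (simp add: borel_open)

lemma measurable_sets_iff:
  "S \<in> measurable_sets M \<longleftrightarrow> (\<forall>c\<in>atlas M. param c -` S \<inter> chart_im c \<in> sets lebesgue)"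
  by (simp add: measurable_sets_def coord_image_eq_vimage)

lemma sigma_algebra_measurable_sets: "sigma_algebra UNIV (measurable_sets M)"
  unfolding sigma_algebra_iff2
proof (intro conjI ballI allI impI)
  show "measurable_sets M \<subseteq> Pow UNIV" by simp
  show "{} \<in> measurable_sets M" by (simp add: measurable_sets_iff)
  show "UNIV - S \<in> measurable_sets M" if "S \<in> measurable_sets M" for S
    unfolding measurable_sets_iff
  proof
    fix c assume c: "c \<in> atlas M"
    have "param c -` (UNIV - S) \<inter> chart_im c = chart_im c - param c -` S \<inter> chart_im c" by blast
    then show "param c -` (UNIV - S) \<inter> chart_im c \<in> sets lebesgue"
      using that c by (auto simp: measurable_sets_iff)
  qed
  show "(\<Union>i. A i) \<in> measurable_sets M" if "range A \<subseteq> measurable_sets M" for A :: "nat \<Rightarrow> _"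
    unfolding measurable_sets_iff
  proof
    fix c assume c: "c \<in> atlas M"
    have "param c -` (\<Union>i. A i) \<inter> chart_im c = (\<Union>i. param c -` A i \<inter> chart_im c)" by blast
    moreover have "param c -` A i \<inter> chart_im c \<in> sets lebesgue" for i
    proof -
      have "A i \<in> measurable_sets M" using that by blast
      then show ?thesis using c by (simp add: measurable_sets_iff)
    qed
    then have "(\<Union>i. param c -` A i \<inter> chart_im c) \<in> sets lebesgue" by (intro sets.countable_UN) blast
    ultimately show "param c -` (\<Union>i. A i) \<inter> chart_im c \<in> sets lebesgue" by simp
  qed
qed

lemma open_measurable_sets: "open S \<Longrightarrow> S \<in> measurable_sets M"
  unfolding measurable_sets_def using open_coord_image[OF M] by (auto simp: Int_commute borel_open)

lemma measurable_sets_Int: "S \<in> measurable_sets M \<Longrightarrow> T \<in> measurable_sets M \<Longrightarrow> S \<inter> T \<in> measurable_sets M"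
proof -
  interpret sigma_algebra UNIV "measurable_sets M" by (rule sigma_algebra_measurable_sets)
  show "S \<in> measurable_sets M \<Longrightarrow> T \<in> measurable_sets M \<Longrightarrow> S \<inter> T \<in> measurable_sets M" by (rule Int)
qed

lemma vimage_param_lebesgue:
  assumes "c \<in> atlas M" "S \<in> measurable_sets M"
  shows "param c -` S \<inter> chart_im c \<in> sets (lebesgue_on (chart_im c))"
  using assms by (simp add: sets_restrict_space_iff measurable_sets_iff)

lemma continuous_on_gram:
  assumes c: "c \<in> atlas M"
  shows "continuous_on (chart_im c) (\<lambda>y. gram (chart_metric M c (param c y)) $ i $ j)"
  using M c unfolding oriented_riemannian_manifold_def gram_def chart_metric_def
  by (auto intro!: smooth_on_continuous)

lemma continuous_on_volume_density:
  assumes c: "c \<in> atlas M"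
  shows "continuous_on (chart_im c) (volume_density M c)"
  unfolding volume_density_eq[abs_def] by (rule continuous_on_real_sqrt[OF continuous_on_det[OF continuous_on_gram[OF c]]])

lemma volume_density_measurable [measurable]:
  "c \<in> atlas M \<Longrightarrow> volume_density M c \<in> borel_measurable (lebesgue_on (chart_im c))"
  by (intro continuous_imp_measurable_on_sets_lebesgue continuous_on_volume_density chart_im_lebesgue)

lemma emeasure_chart_measure:
  assumes c: "c \<in> atlas M" and S: "S \<in> measurable_sets M" "S \<subseteq> chart_dom c"
  shows "emeasure (chart_measure M c) (param c -` S \<inter> chart_im c) =
    (\<integral>\<^sup>+y\<in>coord c ` S. ennreal (volume_density M c y) \<partial>lebesgue)"
proof -
  have eq: "coord c ` S = param c -` S \<inter> chart_im c"
    using coord_image_eq_vimage[OF c, of S] S(2) by (simp add: Int_absorb2)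
  have m: "param c -` S \<inter> chart_im c \<in> sets (lebesgue_on (chart_im c))"
    by (rule vimage_param_lebesgue[OF c S(1)])
  have "emeasure (chart_measure M c) (param c -` S \<inter> chart_im c) =
      (\<integral>\<^sup>+y. ennreal (volume_density M c y) * indicator (param c -` S \<inter> chart_im c) y \<partial>lebesgue_on (chart_im c))"
    unfolding chart_measure_def using volume_density_measurable[OF c] m by (subst emeasure_density) auto
  also have "\<dots> = (\<integral>\<^sup>+y\<in>coord c ` S. ennreal (volume_density M c y) \<partial>lebesgue)"
    unfolding eq using c by (subst nn_integral_restrict_space) (auto intro!: nn_integral_cong simp: indicator_def)
  finally show ?thesis .
qed

text \<open>The atlas may be uncountable, while measures are only countably additive; second
  countability supplies a countable subcover by Lindelof's theorem.\<close>

lemma countable_atlas: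
  obtains C :: "nat \<Rightarrow> ('a, 'n) chart" where "\<And>i. C i \<in> atlas M" "(\<Union>i. chart_dom (C i)) = UNIV"
proof -
  obtain F' where F': "F' \<subseteq> chart_dom ` atlas M" "countable F'" "\<Union>F' = \<Union>(chart_dom ` atlas M)"
    using Lindelof[of "chart_dom ` atlas M"] open_chart_dom[OF M] by blast
  have U: "\<Union>F' = UNIV" using F'(3) UN_chart_dom[OF M] by simp
  then have "F' \<noteq> {}" by auto
  define C where "C i = (SOME c. c \<in> atlas M \<and> chart_dom c = from_nat_into F' i)" for i
  have C: "C i \<in> atlas M \<and> chart_dom (C i) = from_nat_into F' i" for i
  proof -
    have "from_nat_into F' i \<in> chart_dom ` atlas M"
      using from_nat_into[OF \<open>F' \<noteq> {}\<close>, of i] F'(1) by blast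
    then obtain c where "c \<in> atlas M" "from_nat_into F' i = chart_dom c" by (rule imageE)
    then have "\<exists>c. c \<in> atlas M \<and> chart_dom c = from_nat_into F' i" by metis
    then show ?thesis unfolding C_def by (rule someI_ex)
  qed
  have "(\<Union>i. chart_dom (C i)) = UNIV"
    using C range_from_nat_into[OF \<open>F' \<noteq> {}\<close> F'(2)] U by simp
  then show ?thesis using that[of C] C by blast
qed

text \<open>Removing from each chart domain the earlier ones keeps the pieces measurable, though in
  general not open. Measures are then computed piece by piece.\<close>

lemma disjoint_chart_cover:
  obtains C :: "nat \<Rightarrow> ('a, 'n) chart" and D :: "nat \<Rightarrow> 'a set"
  where "\<And>i. C i \<in> atlas M" "\<And>i. D i \<in> measurable_sets M" "\<And>i. D i \<subseteq> chart_dom (C i)"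
    "disjoint_family D" "(\<Union>i. D i) = UNIV"
proof -
  obtain C :: "nat \<Rightarrow> ('a, 'n) chart" where C: "\<And>i. C i \<in> atlas M" "(\<Union>i. chart_dom (C i)) = UNIV"
    by (rule countable_atlas) blast
  interpret sigma_algebra UNIV "measurable_sets M" by (rule sigma_algebra_measurable_sets)
  define D where "D = disjointed (\<lambda>i. chart_dom (C i))"
  have D: "range D \<subseteq> measurable_sets M"
    unfolding D_def using open_measurable_sets[OF open_chart_dom[OF M C(1)]]
    by (intro range_disjointed_sets) blast
  show ?thesis
  proof (rule that[OF C(1)])
    show "D i \<in> measurable_sets M" for i using D by blast
    show "D i \<subseteq> chart_dom (C i)" for i unfolding D_def by (rule disjointed_subset)
    show "disjoint_family D" unfolding D_def by (rule disjoint_family_disjointed)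
    show "(\<Union>i. D i) = UNIV" unfolding D_def UN_disjointed_eq by (rule C(2))
  qed
qed

end

lemma UN_overlaps:
  assumes N: "oriented_riemannian_manifold (N :: ('b::{t2_space,second_countable_topology}, 'n::finite) riem)"
  shows "(\<Union>d\<in>atlas N. coord c ` (chart_dom c \<inter> f -` chart_dom d)) = chart_im c"
  using UN_chart_dom[OF N] by fastforce

lemma countable_UN_overlaps:
  assumes "(\<Union>i. chart_dom (C i)) = UNIV"
  shows "(\<Union>i. coord c ` (chart_dom c \<inter> f -` chart_dom (C i))) = chart_im c"
  using assms by fastforce

section \<open>Change of variables in one pair of charts\<close>

context riemannian_diffeo
begin

lemma open_overlap:
  assumes "c \<in> atlas M" "d \<in> atlas N"
  shows "open (coord c ` (chart_dom c \<inter> f -` chart_dom d))"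
proof -
  have "continuous_on UNIV f" using smooth_f by (simp add: smooth_map_def)
  then have "open (f -` chart_dom d)" using open_chart_dom[OF N assms(2)] by (simp add: open_vimage)
  then show ?thesis by (rule open_coord_image[OF M assms(1)])
qed

lemma chart_rep_measurable:
  assumes c: "c \<in> atlas M" and d: "d \<in> atlas N"
  shows "coord d \<circ> f \<circ> param c \<in>
    lebesgue_on (coord c ` (chart_dom c \<inter> f -` chart_dom d)) \<rightarrow>\<^sub>M lebesgue_on (chart_im d)"
proof -
  define T where "T = coord d ` (chart_dom d \<inter> inv f -` chart_dom c)"
  have T: "open T"
  proof -
    have "continuous_on UNIV (inv f)" using smooth_inv by (simp add: smooth_map_def)
    then have "open (inv f -` chart_dom c)" using open_chart_dom[OF M c] by (simp add: open_vimage)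
    then show ?thesis unfolding T_def by (rule open_coord_image[OF N d])
  qed
  have "(coord c \<circ> inv f \<circ> param d) differentiable_on T"
  proof (rule differentiable_at_imp_differentiable_on)
    fix z assume "z \<in> T"
    then obtain y where "z = coord d y" "y \<in> chart_dom d" "inv f y \<in> chart_dom c" by (auto simp: T_def)
    then show "(coord c \<circ> inv f \<circ> param d) differentiable (at z)"
      using chart_rep_has_derivative[OF smooth_inv d c] differentiableI by blast
  qed
  then have "coord d \<circ> f \<circ> param c \<in>
      lebesgue_on (coord c ` (chart_dom c \<inter> f -` chart_dom d)) \<rightarrow>\<^sub>M lebesgue_on T"
    using open_overlap[OF c d] T
    by (intro measurable_lebesgue_on_differentiable_inverse[where h = "coord c \<circ> inv f \<circ> param d"])
      (auto simp: T_def param_coord[OF M c] param_coord[OF N d] borel_open)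
  moreover have "T \<subseteq> chart_im d" by (auto simp: T_def)
  ultimately show ?thesis
    unfolding measurable_restrict_space2_iff by blast
qed

lemma measurable_sets_vimage:
  assumes S: "S \<in> measurable_sets N"
  shows "f -` S \<in> measurable_sets M"
  unfolding measurable_sets_iff[OF M]
proof
  fix c assume c: "c \<in> atlas M"
  obtain C :: "nat \<Rightarrow> ('b, 'n) chart" where C: "\<And>i. C i \<in> atlas N" "(\<Union>i. chart_dom (C i)) = UNIV"
    by (rule countable_atlas[OF N]) blast
  let ?U = "\<lambda>i. coord c ` (chart_dom c \<inter> f -` chart_dom (C i))"
  have "(coord (C i) \<circ> f \<circ> param c) -` (param (C i) -` S \<inter> chart_im (C i)) \<inter> ?U i \<in> sets lebesgue" for i
    using measurable_sets[OF chart_rep_measurable[OF c C(1)[of i]] vimage_param_lebesgue[OF N C(1) S]]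
      open_overlap[OF c C(1)[of i]]
    by (simp add: sets_restrict_space_iff borel_open)
  moreover have "(coord (C i) \<circ> f \<circ> param c) -` (param (C i) -` S \<inter> chart_im (C i)) \<inter> ?U i =
      param c -` (f -` S) \<inter> ?U i" for i
    using param_coord[OF M c] param_coord[OF N C(1)] by auto
  ultimately have "param c -` (f -` S) \<inter> ?U i \<in> sets lebesgue" for i by simp
  then have "(\<Union>i. param c -` (f -` S) \<inter> ?U i) \<in> sets lebesgue" by (intro sets.countable_UN) blast
  also have "(\<Union>i. param c -` (f -` S) \<inter> ?U i) = param c -` (f -` S) \<inter> chart_im c"
    by (simp only: Int_UN_distrib[symmetric] countable_UN_overlaps[OF C(2)])
  finally show "param c -` (f -` S) \<inter> chart_im c \<in> sets lebesgue" .
qed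

text \<open>The Euclidean change of variables for the coordinate expression of \<open>f\<close>,
  with the determinant converted by \<open>jacobian_volume_density\<close>. With \<open>id\<close>
  it yields consistency of the volume, with \<open>f\<close> the transformation of the
  volume.\<close>

lemma nn_integral_overlap:
  assumes c: "c \<in> atlas M" and d: "d \<in> atlas N" and S: "S \<in> measurable_sets M" "S \<subseteq> chart_dom c" "f ` S \<subseteq> chart_dom d"
  shows "(\<integral>\<^sup>+z\<in>coord d ` f ` S. ennreal (volume_density N d z) \<partial>lebesgue) =
    (\<integral>\<^sup>+y\<in>coord c ` S. ennreal (jacobian M N f (param c y)) * ennreal (volume_density M c y) \<partial>lebesgue)"
proof -
  define g where "g = coord d \<circ> f \<circ> param c"
  define h where "h = coord c \<circ> inv f \<circ> param d"
  define E where "E = coord c ` S"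
  have gE: "g ` E = coord d ` f ` S"
    using S(2) param_coord[OF M c] by (force simp: g_def E_def image_iff)
  have E: "E \<in> sets lebesgue"
    using S c by (auto simp: E_def measurable_sets_def Int_absorb2)
  have der: "(g has_derivative chart_deriv d f c (param c y)) (at y within E)" if "y \<in> E" for y
  proof -
    obtain x where x: "y = coord c x" "x \<in> S" using \<open>y \<in> E\<close> by (auto simp: E_def)
    then have xcd: "x \<in> chart_dom c" "f x \<in> chart_dom d" using S by blast+
    have "param c y = x" using param_coord[OF M c xcd(1)] x(1) by simp
    then show ?thesis
      using has_derivative_at_withinI[OF chart_rep_has_derivative[OF smooth_f c d xcd]] x(1) by (simp only: g_def)
  qed
  have h: "h differentiable_on g ` E"
    unfolding gE
  proof (rule differentiable_at_imp_differentiable_on)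
    fix z assume "z \<in> coord d ` f ` S"
    then obtain x where "z = coord d (f x)" "x \<in> S" by blast
    moreover have "f x \<in> chart_dom d" "inv f (f x) \<in> chart_dom c" using S \<open>x \<in> S\<close> by auto
    ultimately show "h differentiable (at z)"
      using chart_rep_has_derivative[OF smooth_inv d c] differentiableI unfolding h_def by blast
  qed
  have hg: "h (g y) = y" if "y \<in> E" for y
  proof -
    obtain x where x: "y = coord c x" "x \<in> S" using \<open>y \<in> E\<close> by (auto simp: E_def)
    then have "x \<in> chart_dom c" "f x \<in> chart_dom d" using S by auto
    then show ?thesis by (simp add: x h_def g_def param_coord[OF M c] param_coord[OF N d])
  qed
  have gE_sub: "g ` E \<subseteq> chart_im d" unfolding gE by (rule image_mono[OF S(3)])
  have "g differentiable_on E"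
    unfolding differentiable_on_def differentiable_def using der by blast
  then have gE_leb: "g ` E \<in> sets lebesgue"
    by (intro differentiable_image_in_sets_lebesgue[OF E]) auto
  have "continuous_on (g ` E) (volume_density N d)"
    using continuous_on_subset[OF continuous_on_volume_density[OF N d] gE_sub] .
  then have F: "(\<lambda>z. ennreal (volume_density N d z)) \<in> borel_measurable (lebesgue_on (g ` E))"
    by (intro measurable_compose[OF continuous_imp_measurable_on_sets_lebesgue[OF _ gE_leb]] measurable_ennreal)
  have "(\<integral>\<^sup>+z\<in>g ` E. ennreal (volume_density N d z) \<partial>lebesgue) =
      (\<integral>\<^sup>+y\<in>E. ennreal \<bar>det (matrix (chart_deriv d f c (param c y)))\<bar> * ennreal (volume_density N d (g y)) \<partial>lebesgue)"
    by (rule nn_integral_differentiable_image[OF E der h hg F])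
  also have "\<dots> = (\<integral>\<^sup>+y\<in>E. ennreal (jacobian M N f (param c y)) * ennreal (volume_density M c y) \<partial>lebesgue)"
  proof (intro nn_integral_cong)
    fix y
    have "jacobian M N f (param c y) * volume_density M c y =
        \<bar>det (matrix (chart_deriv d f c (param c y)))\<bar> * volume_density N d (g y)" if "y \<in> E"
    proof -
      obtain x where x: "y = coord c x" "x \<in> S" using \<open>y \<in> E\<close> by (auto simp: E_def)
      then have "x \<in> chart_dom c" "f x \<in> chart_dom d" using S by auto
      then show ?thesis using jacobian_volume_density[OF c _ d, of x] by (simp add: x g_def param_coord[OF M c])
    qed
    then have "y \<in> E \<Longrightarrow> ennreal \<bar>det (matrix (chart_deriv d f c (param c y)))\<bar> * ennreal (volume_density N d (g y)) =
        ennreal (jacobian M N f (param c y)) * ennreal (volume_density M c y)"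
      using jacobian_pos by (subst (1 2) ennreal_mult'[symmetric]) (auto simp: less_imp_le)
    then show "ennreal \<bar>det (matrix (chart_deriv d f c (param c y)))\<bar> * ennreal (volume_density N d (g y)) * indicator E y =
        ennreal (jacobian M N f (param c y)) * ennreal (volume_density M c y) * indicator E y"
      by (simp add: indicator_def)
  qed
  finally show ?thesis unfolding gE unfolding E_def .
qed

text \<open>The definition of \<open>jacobian\<close> goes through \<open>SOME\<close>, so
  continuity is read off \<open>jacobian_volume_density\<close>: on each overlap the Jacobian is a
  quotient of continuous functions with positive denominator, and the open overlaps cover the
  chart.\<close>

lemma continuous_on_jacobian:
  assumes c: "c \<in> atlas M"
  shows "continuous_on (chart_im c) (\<lambda>y. jacobian M N f (param c y))"
proof -
  have "continuous_on (coord c ` (chart_dom c \<inter> f -` chart_dom d)) (\<lambda>y. jacobian M N f (param c y))"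
    if d: "d \<in> atlas N" for d
  proof -
    let ?U = "coord c ` (chart_dom c \<inter> f -` chart_dom d)"
    have Uc: "?U \<subseteq> chart_im c" by blast
    have sm: "smooth_on ?U (coord d \<circ> f \<circ> param c)" using smooth_f c d by (simp add: smooth_map_def)
    have *: "chart_deriv d f c (param c y) v = frechet_derivative (coord d \<circ> f \<circ> param c) (at y) v" if "y \<in> ?U" for y v
      using coord_param[OF M c, of y] that Uc by (auto simp: chart_deriv_def)
    have cd: "continuous_on ?U (\<lambda>y. chart_deriv d f c (param c y) v)" for v
      using smooth_on_continuous_frechet[OF sm, of v] by (subst continuous_on_cong[OF refl *]) auto
    have c1: "continuous_on ?U (\<lambda>y. det (matrix (chart_deriv d f c (param c y))))"
      by (intro continuous_on_det) (auto simp: matrix_def intro!: continuous_intros cd)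
    have "(coord d \<circ> f \<circ> param c) ` ?U \<subseteq> chart_im d" using param_coord[OF M c] by auto
    then have c2: "continuous_on ?U (\<lambda>y. volume_density N d ((coord d \<circ> f \<circ> param c) y))"
      using continuous_on_compose2[OF continuous_on_volume_density[OF N d] smooth_on_continuous[OF sm]] by blast
    have c3: "continuous_on ?U (volume_density M c)"
      using continuous_on_subset[OF continuous_on_volume_density[OF M c] Uc] .
    have pos: "volume_density M c y > 0" if "y \<in> ?U" for y using that Uc by (intro volume_density_pos[OF M c]) blast
    have J: "jacobian M N f (param c y) = \<bar>det (matrix (chart_deriv d f c (param c y)))\<bar> *
        volume_density N d ((coord d \<circ> f \<circ> param c) y) / volume_density M c y" if "y \<in> ?U" for y
    proof -
      obtain x where x: "y = coord c x" "x \<in> chart_dom c" "f x \<in> chart_dom d" using \<open>y \<in> ?U\<close> by auto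
      show ?thesis using jacobian_volume_density[OF c x(2) d x(3)] pos[OF that]
        by (simp add: x param_coord[OF M c] field_simps)
    qed
    have "continuous_on ?U (\<lambda>y. \<bar>det (matrix (chart_deriv d f c (param c y)))\<bar> *
        volume_density N d ((coord d \<circ> f \<circ> param c) y) / volume_density M c y)"
      using pos by (intro continuous_on_divide continuous_on_mult continuous_on_rabs c1 c2 c3) (simp add: less_imp_neq[symmetric])
    then show ?thesis by (subst continuous_on_cong[OF refl J]) auto
  qed
  then have "continuous_on (\<Union>d\<in>atlas N. coord c ` (chart_dom c \<inter> f -` chart_dom d)) (\<lambda>y. jacobian M N f (param c y))"
    using open_overlap[OF c] by (intro continuous_on_open_UN) auto
  then show ?thesis by (simp only: UN_overlaps[OF N])
qed

end

section \<open>Existence and uniqueness of the Riemannian volume\<close>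

definition volume_property :: "('a, 'n::finite) riem \<Rightarrow> 'a measure \<Rightarrow> bool" where
  "volume_property M \<mu> \<longleftrightarrow> space \<mu> = UNIV \<and> sets \<mu> = measurable_sets M \<and>
     (\<forall>c\<in>atlas M. \<forall>S\<in>measurable_sets M. S \<subseteq> chart_dom c \<longrightarrow>
        emeasure \<mu> S = (\<integral>\<^sup>+y\<in>coord c ` S. ennreal (volume_density M c y) \<partial>lebesgue))"

lemma volume_property_emeasure:
  "volume_property M \<mu> \<Longrightarrow> c \<in> atlas M \<Longrightarrow> S \<in> measurable_sets M \<Longrightarrow> S \<subseteq> chart_dom c \<Longrightarrow>
    emeasure \<mu> S = (\<integral>\<^sup>+y\<in>coord c ` S. ennreal (volume_density M c y) \<partial>lebesgue)"
  unfolding volume_property_def by blast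

context
  fixes M :: "('a::{t2_space,second_countable_topology}, 'n::{finite,wellorder}) riem"
  assumes M: "oriented_riemannian_manifold M"
begin

lemma chart_volume_consistent:
  assumes c: "c \<in> atlas M" and d: "d \<in> atlas M"
    and S: "S \<in> measurable_sets M" "S \<subseteq> chart_dom c" "S \<subseteq> chart_dom d"
  shows "(\<integral>\<^sup>+z\<in>coord d ` S. ennreal (volume_density M d z) \<partial>lebesgue) =
    (\<integral>\<^sup>+y\<in>coord c ` S. ennreal (volume_density M c y) \<partial>lebesgue)"
  using riemannian_diffeo.nn_integral_overlap[OF riemannian_diffeo_id[OF M] c d S(1,2)] S(3)
  by (simp add: jacobian_id[OF M])

lemma volume_property_exists: "\<exists>\<mu>. volume_property M \<mu>"
proof -
  obtain C :: "nat \<Rightarrow> ('a, 'n) chart" and D :: "nat \<Rightarrow> 'a set"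
    where C: "\<And>i. C i \<in> atlas M" and D: "\<And>i. D i \<in> measurable_sets M" "\<And>i. D i \<subseteq> chart_dom (C i)"
      "disjoint_family D" "(\<Union>i. D i) = UNIV"
    by (rule disjoint_chart_cover[OF M]) (rule that, blast+)
  interpret sigma_algebra UNIV "measurable_sets M" by (rule sigma_algebra_measurable_sets[OF M])
  define V where "V c S = param c -` S \<inter> chart_im c" for c :: "('a, 'n) chart" and S
  \<comment> \<open>Each piece \<open>D i\<close> is measured in its own chart \<open>C i\<close>.
    On a set inside any single chart \<open>c\<close>, consistency lets every summand be computed in
    \<open>c\<close> instead, which gives the prescribed value.\<close>
  define m where "m S = (\<Sum>i. emeasure (chart_measure M (C i)) (V (C i) (S \<inter> D i)))" for S
  have Vsets: "V c S \<in> sets (chart_measure M c)" if "c \<in> atlas M" "S \<in> measurable_sets M" for c S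
    unfolding V_def sets_chart_measure using that by (rule vimage_param_lebesgue[OF M])
  have Vadd: "(\<Sum>j. emeasure (chart_measure M c) (V c (A j))) = emeasure (chart_measure M c) (V c (\<Union>j. A j))"
    if "c \<in> atlas M" "\<And>j. A j \<in> measurable_sets M" "disjoint_family A" for c A
  proof -
    have "(\<Sum>j. emeasure (chart_measure M c) (V c (A j))) = emeasure (chart_measure M c) (\<Union>j. V c (A j))"
    proof (rule suminf_emeasure)
      show "range (\<lambda>j. V c (A j)) \<subseteq> sets (chart_measure M c)" using Vsets that by blast
      show "disjoint_family (\<lambda>j. V c (A j))"
        using that(3) unfolding V_def disjoint_family_on_def by blast
    qed
    also have "(\<Union>j. V c (A j)) = V c (\<Union>j. A j)" unfolding V_def by blast
    finally show ?thesis .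
  qed
  have pos: "positive (measurable_sets M) m" by (simp add: positive_def m_def V_def)
  have add: "countably_additive (measurable_sets M) m"
    unfolding countably_additive_def
  proof (intro allI impI)
    fix A :: "nat \<Rightarrow> 'a set" assume A: "range A \<subseteq> measurable_sets M" "disjoint_family A"
    have A_in: "A j \<inter> D i \<in> measurable_sets M" for i j using A(1) D(1) by blast
    have "(\<Sum>j. m (A j)) = (\<Sum>i. \<Sum>j. emeasure (chart_measure M (C i)) (V (C i) (A j \<inter> D i)))"
      unfolding m_def by (rule suminf_swap_ennreal)
    also have "\<dots> = (\<Sum>i. emeasure (chart_measure M (C i)) (V (C i) (\<Union>j. A j \<inter> D i)))"
    proof (intro suminf_cong Vadd C A_in)
      show "disjoint_family (\<lambda>j. A j \<inter> D i)" for i using A(2) unfolding disjoint_family_on_def by blast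
    qed
    also have "\<dots> = m (\<Union>j. A j)" unfolding m_def by simp
    finally show "(\<Sum>j. m (A j)) = m (\<Union>j. A j)" .
  qed
  define \<mu> where "\<mu> = measure_of UNIV (measurable_sets M) m"
  have "emeasure \<mu> S = (\<integral>\<^sup>+y\<in>coord c ` S. ennreal (volume_density M c y) \<partial>lebesgue)"
    if c: "c \<in> atlas M" and S: "S \<in> measurable_sets M" "S \<subseteq> chart_dom c" for c S
  proof -
    have SD: "S \<inter> D i \<in> measurable_sets M" for i using S(1) D(1) by blast
    have "emeasure \<mu> S = m S" unfolding \<mu>_def by (rule emeasure_measure_of_sigma[OF sigma_algebra_axioms pos add S(1)])
    also have "m S = (\<Sum>i. emeasure (chart_measure M c) (V c (S \<inter> D i)))"
      unfolding m_def
    proof (intro suminf_cong)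
      fix i
      have 1: "S \<inter> D i \<subseteq> chart_dom (C i)" "S \<inter> D i \<subseteq> chart_dom c" using D(2) S(2) by blast+
      show "emeasure (chart_measure M (C i)) (V (C i) (S \<inter> D i)) = emeasure (chart_measure M c) (V c (S \<inter> D i))"
        unfolding V_def emeasure_chart_measure[OF M C SD 1(1)] emeasure_chart_measure[OF M c SD 1(2)]
        by (rule chart_volume_consistent[OF c C SD 1(2,1)])
    qed
    also have "\<dots> = emeasure (chart_measure M c) (V c (\<Union>i. S \<inter> D i))"
    proof (rule Vadd[OF c SD])
      show "disjoint_family (\<lambda>i. S \<inter> D i)" using D(3) unfolding disjoint_family_on_def by blast
    qed
    also have "(\<Union>i. S \<inter> D i) = S" using D(4) by blast
    finally show ?thesis unfolding V_def emeasure_chart_measure[OF M c S] .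
  qed
  moreover have "space \<mu> = UNIV" "sets \<mu> = measurable_sets M"
    by (simp_all add: \<mu>_def space_measure_of_conv sets_measure_of_eq)
  ultimately show ?thesis unfolding volume_property_def by blast
qed

text \<open>The property fixes the measure of sets inside one chart, and every measurable set is a
  countable disjoint union of such sets.\<close>

lemma volume_property_unique:
  assumes \<mu>: "volume_property M \<mu>" and \<nu>: "volume_property M \<nu>"
  shows "\<mu> = \<nu>"
proof (rule measure_eqI)
  have s: "sets \<mu> = measurable_sets M" "sets \<nu> = measurable_sets M"
    using \<mu> \<nu> by (simp_all add: volume_property_def)
  then show "sets \<mu> = sets \<nu>" by simp
  obtain C :: "nat \<Rightarrow> ('a, 'n) chart" and D :: "nat \<Rightarrow> 'a set"
    where C: "\<And>i. C i \<in> atlas M" and D: "\<And>i. D i \<in> measurable_sets M" "\<And>i. D i \<subseteq> chart_dom (C i)"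
      "disjoint_family D" "(\<Union>i. D i) = UNIV"
    by (rule disjoint_chart_cover[OF M]) (rule that, blast+)
  fix S assume "S \<in> sets \<mu>"
  then have S: "S \<in> measurable_sets M" using s by simp
  have SD: "S \<inter> D i \<in> measurable_sets M" "S \<inter> D i \<subseteq> chart_dom (C i)" for i
    using measurable_sets_Int[OF M S D(1)] D(2) by blast+
  have U: "(\<Union>i. S \<inter> D i) = S" using D(4) by blast
  have dis: "disjoint_family (\<lambda>i. S \<inter> D i)" using D(3) unfolding disjoint_family_on_def by blast
  have eq: "emeasure \<mu> (S \<inter> D i) = emeasure \<nu> (S \<inter> D i)" for i
    using volume_property_emeasure[OF \<mu> C SD] volume_property_emeasure[OF \<nu> C SD] by simp
  have "emeasure \<mu> S = (\<Sum>i. emeasure \<mu> (S \<inter> D i))"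
    using suminf_emeasure[OF _ dis, of \<mu>] SD(1) s U by (simp add: image_subset_iff)
  also have "\<dots> = (\<Sum>i. emeasure \<nu> (S \<inter> D i))" by (simp add: eq)
  also have "\<dots> = emeasure \<nu> S"
    using suminf_emeasure[OF _ dis, of \<nu>] SD(1) s U by (simp add: image_subset_iff)
  finally show "emeasure \<mu> S = emeasure \<nu> S" .
qed

lemma volume_property_volume: "volume_property M (volume M)"
proof -
  have "\<exists>!\<mu>. volume_property M \<mu>" using volume_property_exists volume_property_unique by blast
  then have "volume_property M (THE \<mu>. volume_property M \<mu>)" by (rule theI')
  then show ?thesis by (simp add: volume_def volume_property_def)
qed

lemma volume_eqI: "volume_property M \<mu> \<Longrightarrow> \<mu> = volume M"
  using volume_property_unique volume_property_volume by blast

lemma space_volume [simp]: "space (volume M) = UNIV"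
  and sets_volume: "sets (volume M) = measurable_sets M"
  using volume_property_volume by (simp_all add: volume_property_def)

lemma emeasure_volume:
  "c \<in> atlas M \<Longrightarrow> S \<in> measurable_sets M \<Longrightarrow> S \<subseteq> chart_dom c \<Longrightarrow>
    emeasure (volume M) S = (\<integral>\<^sup>+y\<in>coord c ` S. ennreal (volume_density M c y) \<partial>lebesgue)"
  using volume_property_volume unfolding volume_property_def by blast

lemma borel_measurable_volumeI:
  fixes u :: "'a \<Rightarrow> 'c::topological_space"
  assumes "\<And>c. c \<in> atlas M \<Longrightarrow> (\<lambda>y. u (param c y)) \<in> borel_measurable (lebesgue_on (chart_im c))"
  shows "u \<in> borel_measurable (volume M)"
proof (rule measurableI)
  fix B :: "'c set" assume B: "B \<in> sets borel"
  have "param c -` (u -` B) \<inter> chart_im c \<in> sets lebesgue" if c: "c \<in> atlas M" for c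
  proof -
    have "(\<lambda>y. u (param c y)) -` B \<inter> space (lebesgue_on (chart_im c)) \<in> sets (lebesgue_on (chart_im c))"
      using assms[OF c] B by (rule measurable_sets)
    moreover have "(\<lambda>y. u (param c y)) -` B \<inter> space (lebesgue_on (chart_im c)) = param c -` (u -` B) \<inter> chart_im c"
      by auto
    ultimately show ?thesis using chart_im_lebesgue[OF M c] by (simp add: sets_restrict_space_iff)
  qed
  then show "u -` B \<inter> space (volume M) \<in> sets (volume M)"
    by (simp add: sets_volume measurable_sets_iff[OF M])
qed simp

section \<open>Integration over a piece of a chart\<close>

lemma param_measurable:
  assumes c: "c \<in> atlas M"
  shows "param c \<in> chart_measure M c \<rightarrow>\<^sub>M volume M"
proof (rule measurableI)
  fix S assume "S \<in> sets (volume M)"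
  then show "param c -` S \<inter> space (chart_measure M c) \<in> sets (chart_measure M c)"
    using vimage_param_lebesgue[OF M c] by (simp add: sets_volume sets_chart_measure)
qed simp

text \<open>The volume restricted to \<open>chart_dom c\<close> is the image of
  \<open>chart_measure M c\<close> under \<open>param c\<close>; this needs checking on sets only
  and then applies to all measurable integrands.\<close>

lemma nn_integral_volume_chart:
  assumes c: "c \<in> atlas M" and S: "S \<in> measurable_sets M" "S \<subseteq> chart_dom c"
    and u: "u \<in> borel_measurable (volume M)"
  shows "(\<integral>\<^sup>+x\<in>S. u x \<partial>volume M) =
    (\<integral>\<^sup>+y\<in>coord c ` S. u (param c y) * ennreal (volume_density M c y) \<partial>lebesgue)"
proof -
  have dom: "chart_dom c \<in> sets (volume M)" "S \<in> sets (volume M)"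
    using open_measurable_sets[OF M open_chart_dom[OF M c]] S by (simp_all add: sets_volume)
  have eq: "density (volume M) (indicator (chart_dom c)) = distr (chart_measure M c) (volume M) (param c)"
  proof (rule measure_eqI)
    fix A assume "A \<in> sets (density (volume M) (indicator (chart_dom c)))"
    then have A: "A \<in> sets (volume M)" by simp
    then have A': "A \<inter> chart_dom c \<in> measurable_sets M"
      using dom by (simp add: measurable_sets_Int[OF M] sets_volume)
    have "emeasure (density (volume M) (indicator (chart_dom c))) A = emeasure (volume M) (A \<inter> chart_dom c)"
      using dom A by (simp add: emeasure_density indicator_inter_arith[symmetric] Int_commute)
    also have "\<dots> = emeasure (chart_measure M c) (param c -` (A \<inter> chart_dom c) \<inter> chart_im c)"
      using emeasure_volume[OF c A'] emeasure_chart_measure[OF M c A'] by simp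
    also have "param c -` (A \<inter> chart_dom c) \<inter> chart_im c = param c -` A \<inter> chart_im c"
      using param_in_chart_dom[OF M c] by blast
    finally show "emeasure (density (volume M) (indicator (chart_dom c))) A =
        emeasure (distr (chart_measure M c) (volume M) (param c)) A"
      using A by (simp add: emeasure_distr[OF param_measurable[OF c]])
  qed simp
  have uS: "(\<lambda>x. u x * indicator S x) \<in> borel_measurable (volume M)" using u dom by measurable
  have "(\<integral>\<^sup>+x\<in>S. u x \<partial>volume M) = (\<integral>\<^sup>+x. indicator (chart_dom c) x * (u x * indicator S x) \<partial>volume M)"
    using S(2) by (intro nn_integral_cong) (auto simp: indicator_def)
  also have "\<dots> = (\<integral>\<^sup>+x. u x * indicator S x \<partial>density (volume M) (indicator (chart_dom c)))"
    using dom uS by (subst nn_integral_density) auto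
  also have "\<dots> = (\<integral>\<^sup>+y. u (param c y) * indicator S (param c y) \<partial>chart_measure M c)"
    unfolding eq by (rule nn_integral_distr[OF param_measurable[OF c]]) (use uS in simp)
  also have "\<dots> = (\<integral>\<^sup>+y. ennreal (volume_density M c y) * (u (param c y) * indicator S (param c y)) \<partial>lebesgue_on (chart_im c))"
    using volume_density_measurable[OF M c] measurable_compose[OF param_measurable[OF c] uS]
    unfolding chart_measure_def by (subst nn_integral_density) auto
  also have "\<dots> = (\<integral>\<^sup>+y\<in>chart_im c. ennreal (volume_density M c y) * (u (param c y) * indicator S (param c y)) \<partial>lebesgue)"
    using chart_im_lebesgue[OF M c] by (subst nn_integral_restrict_space) auto
  also have "\<dots> = (\<integral>\<^sup>+y\<in>coord c ` S. u (param c y) * ennreal (volume_density M c y) \<partial>lebesgue)"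
  proof (intro nn_integral_cong)
    fix y
    have "coord c ` S = param c -` S \<inter> chart_im c"
      using coord_image_eq_vimage[OF M c, of S] S(2) by (simp add: Int_absorb2)
    then have "indicator (coord c ` S) y = (indicator S (param c y) * indicator (chart_im c) y :: ennreal)"
      by (simp add: indicator_def)
    then show "ennreal (volume_density M c y) * (u (param c y) * indicator S (param c y)) * indicator (chart_im c) y =
        u (param c y) * ennreal (volume_density M c y) * indicator (coord c ` S) y"
      by (simp add: mult_ac)
  qed
  finally show ?thesis .
qed

end

section \<open>Change of variables between the two manifolds\<close>

context riemannian_diffeo
begin

lemma riemannian_diffeo_inv: "riemannian_diffeo N M (inv f)"
  using M N bij_f smooth_f smooth_inv
  by (simp add: riemannian_diffeo_def diffeomorphism_def bij_imp_bij_inv inv_inv_eq)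

lemma f_measurable: "f \<in> volume M \<rightarrow>\<^sub>M volume N"
  by (rule measurableI) (simp_all add: sets_volume[OF N] sets_volume[OF M] space_volume[OF M] space_volume[OF N] measurable_sets_vimage)

lemma jacobian_measurable: "jacobian M N f \<in> borel_measurable (volume M)"
  by (intro borel_measurable_volumeI[OF M] continuous_imp_measurable_on_sets_lebesgue continuous_on_jacobian
      chart_im_lebesgue[OF M])

text \<open>By uniqueness of the volume it suffices to compute the left-hand measure of a set inside
  one chart of \<open>N\<close>.\<close>

lemma distr_jacobian: "distr (density (volume M) (\<lambda>x. ennreal (jacobian M N f x))) (volume N) f = volume N"
proof (rule volume_eqI[OF N])
  let ?\<nu> = "distr (density (volume M) (\<lambda>x. ennreal (jacobian M N f x))) (volume N) f"
  have J: "(\<lambda>x. ennreal (jacobian M N f x)) \<in> borel_measurable (volume M)" using jacobian_measurable by measurable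
  obtain C :: "nat \<Rightarrow> ('a, 'n) chart" and D :: "nat \<Rightarrow> 'a set"
    where C: "\<And>i. C i \<in> atlas M" and D: "\<And>i. D i \<in> measurable_sets M" "\<And>i. D i \<subseteq> chart_dom (C i)"
      "disjoint_family D" "(\<Union>i. D i) = UNIV"
    by (rule disjoint_chart_cover[OF M]) (rule that, blast+)
  have "emeasure ?\<nu> S = (\<integral>\<^sup>+y\<in>coord d ` S. ennreal (volume_density N d y) \<partial>lebesgue)"
    if d: "d \<in> atlas N" and S: "S \<in> measurable_sets N" "S \<subseteq> chart_dom d" for d S
  proof -
    \<comment> \<open>The preimage of \<open>S\<close> may meet many charts of \<open>M\<close>.
      Each \<open>T i\<close> lies in a single one and is mapped into the chart \<open>d\<close>, so
      \<open>nn_integral_overlap\<close> applies.\<close>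
    define T where "T i = f -` S \<inter> D i" for i
    have T: "T i \<in> measurable_sets M" "T i \<subseteq> chart_dom (C i)" "f ` T i \<subseteq> chart_dom d" for i
      using measurable_sets_Int[OF M measurable_sets_vimage[OF S(1)] D(1)] D(2) S(2) by (auto simp: T_def)
    have fT: "f ` T i \<in> measurable_sets N" for i
    proof -
      have "f ` T i = inv f -` T i" 
        using bij_vimage_eq_inv_image[OF bij_imp_bij_inv[OF bij_f], of "T i"] by (simp add: inv_inv_eq[OF bij_f])
      then show ?thesis
        using riemannian_diffeo.measurable_sets_vimage[OF riemannian_diffeo_inv T(1)] by simp
    qed
    have disT: "disjoint_family T" using D(3) unfolding T_def disjoint_family_on_def by blast
    have UT: "(\<Union>i. T i) = f -` S" using D(4) unfolding T_def by blast
    have "emeasure ?\<nu> S = emeasure (density (volume M) (\<lambda>x. ennreal (jacobian M N f x))) (\<Union>i. T i)"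
      using S(1) f_measurable by (subst emeasure_distr) (simp_all add: sets_volume[OF N] space_volume[OF M] UT)
    also have "\<dots> = (\<Sum>i. emeasure (density (volume M) (\<lambda>x. ennreal (jacobian M N f x))) (T i))"
      using T(1) by (intro suminf_emeasure[OF _ disT, symmetric]) (auto simp: sets_volume[OF M])
    also have "\<dots> = (\<Sum>i. emeasure (volume N) (f ` T i))"
    proof (intro suminf_cong)
      fix i
      have "emeasure (density (volume M) (\<lambda>x. ennreal (jacobian M N f x))) (T i) =
          (\<integral>\<^sup>+x\<in>T i. ennreal (jacobian M N f x) \<partial>volume M)"
        using T(1)[of i] by (intro emeasure_density[OF J]) (simp add: sets_volume[OF M])
      also have "\<dots> = (\<integral>\<^sup>+z\<in>coord d ` f ` T i. ennreal (volume_density N d z) \<partial>lebesgue)"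
        unfolding nn_integral_volume_chart[OF M C T(1,2) J] nn_integral_overlap[OF C d T] ..
      also have "\<dots> = emeasure (volume N) (f ` T i)"
        by (rule emeasure_volume[OF N d fT T(3), symmetric])
      finally show "emeasure (density (volume M) (\<lambda>x. ennreal (jacobian M N f x))) (T i) = emeasure (volume N) (f ` T i)" .
    qed
    also have "\<dots> = emeasure (volume N) (\<Union>i. f ` T i)"
    proof (rule suminf_emeasure)
      show "range (\<lambda>i. f ` T i) \<subseteq> sets (volume N)" using fT by (auto simp: sets_volume[OF N])
      show "disjoint_family (\<lambda>i. f ` T i)"
        using disT unfolding disjoint_family_on_def by (simp add: image_Int[OF bij_is_inj[OF bij_f], symmetric])
    qed
    also have "(\<Union>i. f ` T i) = S"
      by (simp only: image_UN[symmetric] UT surj_image_vimage_eq[OF bij_is_surj[OF bij_f]])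
    finally show ?thesis using emeasure_volume[OF N d S] by simp
  qed
  then show "volume_property N ?\<nu>"
    by (simp add: volume_property_def space_volume[OF N] sets_volume[OF N])
qed

lemma nn_integral_jacobian:
  assumes u: "u \<in> borel_measurable (volume N)"
  shows "(\<integral>\<^sup>+z. u z \<partial>volume N) = (\<integral>\<^sup>+x. ennreal (jacobian M N f x) * u (f x) \<partial>volume M)"
proof -
  have J: "(\<lambda>x. ennreal (jacobian M N f x)) \<in> borel_measurable (volume M)" using jacobian_measurable by measurable
  have "(\<integral>\<^sup>+z. u z \<partial>volume N) =
      (\<integral>\<^sup>+z. u z \<partial>distr (density (volume M) (\<lambda>x. ennreal (jacobian M N f x))) (volume N) f)"
    by (simp only: distr_jacobian)
  also have "\<dots> = (\<integral>\<^sup>+x. u (f x) \<partial>density (volume M) (\<lambda>x. ennreal (jacobian M N f x)))"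
    using f_measurable u by (intro nn_integral_distr) auto
  also have "\<dots> = (\<integral>\<^sup>+x. ennreal (jacobian M N f x) * u (f x) \<partial>volume M)"
    using measurable_compose[OF f_measurable u] by (intro nn_integral_density J) auto
  finally show ?thesis .
qed

text \<open>Since the Jacobian is positive everywhere, multiplying the volume of \<open>M\<close> by
  it creates no new null sets. This lets the pullback descend to classes of forms equal almost
  everywhere.\<close>

lemma AE_volume_pullback:
  assumes "AE y in volume N. P y"
  shows "AE x in volume M. P (f x)"
proof -
  have J: "(\<lambda>x. ennreal (jacobian M N f x)) \<in> borel_measurable (volume M)" using jacobian_measurable by measurable
  have "AE y in distr (density (volume M) (\<lambda>x. ennreal (jacobian M N f x))) (volume N) f. P y"
    using assms by (simp only: distr_jacobian)
  then have "AE x in density (volume M) (\<lambda>x. ennreal (jacobian M N f x)). P (f x)"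
    using f_measurable by (intro AE_distrD[of f _ "volume N"]) auto
  then have "AE x in volume M. 0 < ennreal (jacobian M N f x) \<longrightarrow> P (f x)"
    by (simp add: AE_density[OF J])
  then show ?thesis using jacobian_pos by (simp add: ennreal_less_zero_iff)
qed

end

section \<open>Measurability of forms and norms\<close>

text \<open>In a chart, \<open>covector_norm_linear_image\<close> passes to coordinate components;
  there the norm is the root of a polynomial in measurable components and the continuous entries of
  the inverse metric.\<close>

lemma covector_norm_measurable:
  fixes M :: "('a::{t2_space,second_countable_topology}, 'n::{finite,wellorder}) riem"
  assumes M: "oriented_riemannian_manifold M" and \<omega>: "measurable_form M k \<omega>"
  shows "(\<lambda>x. covector_norm (metric M x) k (\<omega> x)) \<in> borel_measurable (volume M)"
proof (rule borel_measurable_volumeI[OF M])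
  fix c assume c: "c \<in> atlas M"
  have alt: "alternating_form k (\<omega> x)" for x using \<omega> by (simp add: measurable_form_def)
  define G where "G y = matrix_inv (gram (chart_metric M c (param c y)))" for y
  define W where "W a y = \<omega> (param c y) (\<lambda>j. coord_vec M c (param c y) (axis (a j) 1))" for a :: "nat \<Rightarrow> 'n" and y
  have W: "W a \<in> borel_measurable (lebesgue_on (chart_im c))" for a
    using \<omega> c unfolding measurable_form_def W_def by simp
  have "continuous_on (chart_im c) (\<lambda>y. gram (chart_metric M c (param c y)) $ i $ j)" for i j
    by (rule continuous_on_gram[OF M c])
  moreover have "det (gram (chart_metric M c (param c y))) \<noteq> 0" if "y \<in> chart_im c" for y
    using det_gram_pos[OF chart_metric_inner_product[OF M c param_in_chart_dom[OF M c that]]] by simp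
  ultimately have "continuous_on (chart_im c) (\<lambda>y. G y $ i $ j)" for i j
    unfolding G_def by (rule continuous_on_matrix_inv_nth)
  then have G: "(\<lambda>y. G y $ i $ j) \<in> borel_measurable (lebesgue_on (chart_im c))" for i j
    by (intro continuous_imp_measurable_on_sets_lebesgue chart_im_lebesgue[OF M c])
  have "(\<lambda>y. sqrt ((\<Sum>a\<in>{..<k} \<rightarrow>\<^sub>E UNIV. \<Sum>b\<in>{..<k} \<rightarrow>\<^sub>E UNIV.
      (\<Prod>j<k. G y $ a j $ b j) * (W a y * W b y)) / fact k)) \<in> borel_measurable (lebesgue_on (chart_im c))"
    using G W by measurable
  moreover have "covector_norm (metric M (param c y)) k (\<omega> (param c y)) =
      sqrt ((\<Sum>a\<in>{..<k} \<rightarrow>\<^sub>E UNIV. \<Sum>b\<in>{..<k} \<rightarrow>\<^sub>E UNIV.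
      (\<Prod>j<k. G y $ a j $ b j) * (W a y * W b y)) / fact k)" if "y \<in> chart_im c" for y
  proof -
    define x where "x = param c y"
    have x: "x \<in> chart_dom c" unfolding x_def using param_in_chart_dom[OF M c that] .
    note A = linear_coord_vec[OF M c x] inj_coord_vec[OF M c x]
    have "covector_norm (metric M x) k (\<omega> x) =
        covector_norm (chart_metric M c x) k (\<lambda>v. \<omega> x (\<lambda>j. coord_vec M c x (v j)))"
      unfolding chart_metric_def by (rule covector_norm_linear_image[OF alt metric_inner_product[OF M] A, symmetric])
    then show ?thesis
      using covector_norm_gram[OF alternating_form_compose_linear[OF alt A(1)] chart_metric_inner_product[OF M c x]]
      unfolding G_def W_def x_def by simp
  qed
  ultimately show "(\<lambda>y. covector_norm (metric M (param c y)) k (\<omega> (param c y))) \<in> borel_measurable (lebesgue_on (chart_im c))"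
    by (subst measurable_cong) auto
qed

context riemannian_diffeo
begin

text \<open>On each overlap of charts the pullback is a finite sum of products of first derivatives
  of the coordinate expression, which are continuous, and components of \<omega> along it. Countably
  many overlaps cover a chart.\<close>

lemma measurable_form_pullback:
  assumes \<omega>: "measurable_form N k \<omega>"
  shows "measurable_form M k (pullback M N f \<omega>)"
  unfolding measurable_form_def
proof (intro conjI allI ballI)
  have alt: "alternating_form k (\<omega> z)" for z using \<omega> by (simp add: measurable_form_def)
  show "alternating_form k (pullback M N f \<omega> x)" for x
    unfolding pullback_def by (rule alternating_form_compose_linear[OF alt linear_differential])
  fix c v assume c: "c \<in> atlas M"
  obtain C :: "nat \<Rightarrow> ('b, 'n) chart" where C: "\<And>i. C i \<in> atlas N" "(\<Union>i. chart_dom (C i)) = UNIV"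
    by (rule countable_atlas[OF N]) blast
  let ?h = "\<lambda>y. pullback M N f \<omega> (param c y) (\<lambda>j. coord_vec M c (param c y) (v j))"
  have "?h \<in> borel_measurable (lebesgue_on (coord c ` (chart_dom c \<inter> f -` chart_dom d)))"
    if d: "d \<in> atlas N" for d
  proof -
    let ?U = "coord c ` (chart_dom c \<inter> f -` chart_dom d)"
    let ?\<psi> = "coord d \<circ> f \<circ> param c"
    \<comment> \<open>Measurability of \<omega> is given only for constant coordinate vectors,
      whereas the pushed-forward vectors vary with \<open>y\<close>; hence the expansion in the
      basis components \<open>W a\<close>.\<close>
    define W where "W a z = \<omega> (param d z) (\<lambda>j. coord_vec N d (param d z) (axis (a j) 1))" for a :: "nat \<Rightarrow> 'n" and z
    have "W a \<in> borel_measurable (lebesgue_on (chart_im d))" for a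
      using \<omega> d unfolding measurable_form_def W_def by simp
    then have W: "(\<lambda>y. W a (?\<psi> y)) \<in> borel_measurable (lebesgue_on ?U)" for a
      by (rule measurable_compose[OF chart_rep_measurable[OF c d]])
    have sm: "smooth_on ?U ?\<psi>" using smooth_f c d by (simp add: smooth_map_def)
    have U: "?U \<in> sets lebesgue" using open_overlap[OF c d] by (simp add: borel_open)
    have D: "(\<lambda>y. frechet_derivative ?\<psi> (at y) u $ i) \<in> borel_measurable (lebesgue_on ?U)" for u i
      by (intro continuous_imp_measurable_on_sets_lebesgue U continuous_intros smooth_on_continuous_frechet[OF sm])
    have "(\<lambda>y. \<Sum>a\<in>{..<k} \<rightarrow>\<^sub>E UNIV. (\<Prod>j<k. frechet_derivative ?\<psi> (at y) (v j) $ a j) * W a (?\<psi> y))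
        \<in> borel_measurable (lebesgue_on ?U)"
      using D W by (intro borel_measurable_sum borel_measurable_times borel_measurable_prod)
    moreover have "?h y = (\<Sum>a\<in>{..<k} \<rightarrow>\<^sub>E UNIV. (\<Prod>j<k. frechet_derivative ?\<psi> (at y) (v j) $ a j) * W a (?\<psi> y))"
      if "y \<in> ?U" for y
    proof -
      obtain x where x: "y = coord c x" "x \<in> chart_dom c" "f x \<in> chart_dom d" using \<open>y \<in> ?U\<close> by blast
      have px: "param c y = x" "param d (coord d (f x)) = f x"
        using param_coord[OF M c x(2)] param_coord[OF N d x(3)] x(1) by simp_all
      note lin = linear_coord_vec[OF N d x(3)]
      define w where "w j = chart_deriv d f c x (v j)" for j
      have "?h y = \<omega> (f x) (\<lambda>j. coord_vec N d (f x) (w j))"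
        unfolding px pullback_def differential_coord_vec[OF M N smooth_f c x(2) d x(3)] w_def ..
      also have "(\<lambda>j. coord_vec N d (f x) (w j)) = (\<lambda>j. \<Sum>i\<in>UNIV. w j $ i *\<^sub>R coord_vec N d (f x) (axis i 1))"
      proof
        fix j
        have "w j = (\<Sum>i\<in>UNIV. w j $ i *\<^sub>R axis i 1)"
          using basis_expansion[of "w j"] by (simp add: scalar_mult_eq_scaleR)
        then have "coord_vec N d (f x) (w j) = coord_vec N d (f x) (\<Sum>i\<in>UNIV. w j $ i *\<^sub>R axis i 1)" by simp
        then show "coord_vec N d (f x) (w j) = (\<Sum>i\<in>UNIV. w j $ i *\<^sub>R coord_vec N d (f x) (axis i 1))"
          by (simp add: linear_sum[OF lin] linear_cmul[OF lin])
      qed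
      also have "\<omega> (f x) (\<lambda>j. \<Sum>i\<in>UNIV. w j $ i *\<^sub>R coord_vec N d (f x) (axis i 1)) =
          (\<Sum>a\<in>{..<k} \<rightarrow>\<^sub>E UNIV. (\<Prod>j<k. w j $ a j) * \<omega> (f x) (\<lambda>j. coord_vec N d (f x) (axis (a j) 1)))"
        by (rule alternating_form_expand[OF alt])
      also have "\<dots> = (\<Sum>a\<in>{..<k} \<rightarrow>\<^sub>E UNIV. (\<Prod>j<k. frechet_derivative ?\<psi> (at y) (v j) $ a j) * W a (?\<psi> y))"
        unfolding W_def w_def chart_deriv_def o_apply px x(1)[symmetric] px ..
      finally show ?thesis .
    qed
    ultimately show ?thesis by (subst measurable_cong) auto
  qed
  then have "?h \<in> borel_measurable (lebesgue_on (\<Union>i. coord c ` (chart_dom c \<inter> f -` chart_dom (C i))))"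
    using open_overlap[OF c C(1)] C(1) by (intro measurable_lebesgue_on_UN) (auto simp: borel_open)
  then show "?h \<in> borel_measurable (lebesgue_on (chart_im c))"
    unfolding countable_UN_overlaps[OF C(2)] .
qed

lemma covector_norm_pullback:
  assumes "alternating_form k (\<omega> (f x))"
  shows "covector_norm (metric M x) k (pullback M N f \<omega> x) \<le>
    sigma M N k f x * covector_norm (metric N (f x)) k (\<omega> (f x))"
proof -
  define \<sigma> where "\<sigma> = (SOME \<sigma>. singular_values (metric M x) (metric N (f x)) (differential M N f x) \<sigma>)"
  have "\<exists>\<sigma>. singular_values (metric M x) (metric N (f x)) (differential M N f x) \<sigma>"
    using singular_values_exist[OF metric_inner_product[OF M] metric_inner_product[OF N] linear_differential] by blast
  then have \<sigma>: "singular_values (metric M x) (metric N (f x)) (differential M N f x) \<sigma>"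
    unfolding \<sigma>_def by (rule someI_ex)
  show ?thesis
    using covector_norm_pullback_le[OF assms metric_inner_product[OF M] metric_inner_product[OF N]
      linear_differential inj_differential \<sigma>]
    by (simp add: pullback_def sigma_def \<sigma>_def[symmetric])
qed

end

section \<open>Extended powers and Hoelder's inequality\<close>

lemma epowr_ennreal: "0 \<le> r \<Longrightarrow> epowr (ennreal r) a = ennreal (r powr a)"
  by (simp add: epowr_def)

lemma epowr_mono:
  assumes "x \<le> y" "0 \<le> a"
  shows "epowr x a \<le> epowr y a"
proof (cases "y = \<infinity>")
  case False
  then show ?thesis
    using assms by (cases x; cases y) (auto simp: epowr_ennreal powr_mono2 top_unique)
qed (simp add: epowr_def)

text \<open>Young's inequality for \<open>X\<close> and \<open>Y\<close> divided by their norms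
  \<open>u\<close> and \<open>v\<close>, then integrated; the weights 1 / a and 1 / b add up to 1.
  If one norm is 0, the product vanishes almost everywhere.\<close>

lemma nn_integral_Holder:
  fixes X Y :: "'a \<Rightarrow> real"
  assumes X: "X \<in> borel_measurable M" "\<And>x. 0 \<le> X x" and Y: "Y \<in> borel_measurable M" "\<And>x. 0 \<le> Y x"
    and ab: "1 < a" "1 < b" "1 / a + 1 / b = 1"
    and I: "(\<integral>\<^sup>+x. ennreal (X x powr a) \<partial>M) = ennreal r" "0 \<le> r"
      "(\<integral>\<^sup>+x. ennreal (Y x powr b) \<partial>M) = ennreal s" "0 \<le> s"
  shows "(\<integral>\<^sup>+x. ennreal (X x * Y x) \<partial>M) \<le> ennreal (r powr (1 / a) * s powr (1 / b))"
proof (cases "r = 0 \<or> s = 0")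
  case True
  have "AE x in M. X x = 0 \<or> Y x = 0"
  proof (cases "r = 0")
    case True
    then have "AE x in M. ennreal (X x powr a) = 0"
      using I(1) X(1) by (subst nn_integral_0_iff_AE[symmetric]) auto
    then show ?thesis by eventually_elim (use X(2) in \<open>auto simp: ennreal_eq_0_iff\<close>)
  next
    case False
    then have "AE x in M. ennreal (Y x powr b) = 0"
      using I(3) Y(1) \<open>r = 0 \<or> s = 0\<close> by (subst nn_integral_0_iff_AE[symmetric]) auto
    then show ?thesis by eventually_elim (use Y(2) in \<open>auto simp: ennreal_eq_0_iff\<close>)
  qed
  then have "(\<integral>\<^sup>+x. ennreal (X x * Y x) \<partial>M) = (\<integral>\<^sup>+x. 0 \<partial>M)"
    by (intro nn_integral_cong_AE) auto
  then show ?thesis by simp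
next
  case False
  then have rs: "r > 0" "s > 0" using I by auto
  define u v where "u = r powr (1 / a)" and "v = s powr (1 / b)"
  have uv: "u > 0" "v > 0" "u powr a = r" "v powr b = s"
    using rs ab by (auto simp: u_def v_def powr_powr)
  have le: "X x * Y x \<le> u * v * (1 / (r * a) * X x powr a + 1 / (s * b) * Y x powr b)" for x
  proof -
    have "(X x / u) * (Y x / v) \<le> (X x / u) powr a / a + (Y x / v) powr b / b"
      using Youngs_inequality[of a b "X x / u" "Y x / v"] ab X(2) Y(2) uv by simp
    also have "\<dots> = 1 / (r * a) * X x powr a + 1 / (s * b) * Y x powr b"
      using uv X(2) Y(2) by (simp add: powr_divide)
    finally have "u * v * ((X x / u) * (Y x / v)) \<le> u * v * (1 / (r * a) * X x powr a + 1 / (s * b) * Y x powr b)"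
      using uv by (intro mult_left_mono) auto
    then show ?thesis using uv by simp
  qed
  have "(\<integral>\<^sup>+x. ennreal (X x * Y x) \<partial>M) \<le>
      (\<integral>\<^sup>+x. ennreal (u * v) * (ennreal (1 / (r * a)) * ennreal (X x powr a) + ennreal (1 / (s * b)) * ennreal (Y x powr b)) \<partial>M)"
  proof (intro nn_integral_mono)
    fix x
    have "ennreal (u * v) * (ennreal (1 / (r * a)) * ennreal (X x powr a) + ennreal (1 / (s * b)) * ennreal (Y x powr b)) =
        ennreal (u * v * (1 / (r * a) * X x powr a + 1 / (s * b) * Y x powr b))"
      using uv rs ab by (simp add: ennreal_mult[symmetric] ennreal_plus[symmetric] del: ennreal_plus)
    then show "ennreal (X x * Y x) \<le> ennreal (u * v) *
        (ennreal (1 / (r * a)) * ennreal (X x powr a) + ennreal (1 / (s * b)) * ennreal (Y x powr b))"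
      using le[of x] by (simp add: ennreal_leI)
  qed
  also have "\<dots> = ennreal (u * v) * (ennreal (1 / (r * a)) * ennreal r + ennreal (1 / (s * b)) * ennreal s)"
    using X(1) Y(1) by (simp add: nn_integral_cmult nn_integral_add I)
  also have "\<dots> = ennreal (u * v) * ennreal (1 / a + 1 / b)"
    using rs ab by (simp add: ennreal_mult[symmetric] ennreal_plus[symmetric] del: ennreal_plus)
  finally show ?thesis by (simp add: ab u_def v_def)
qed

section \<open>The estimate\<close>

context riemannian_diffeo
begin

lemma form_norm_pullback_le:
  assumes \<omega>: "measurable_form N k \<omega>" "form_norm N q k \<omega> < \<infinity>"
    and pq: "1 \<le> p" "p \<le> q" and t: "t = (if p = q then \<infinity> else ennreal (p / (q - p)))"
  shows "form_norm M p k (pullback M N f \<omega>) \<le> epowr (distortion M N q t k f) (1 / q) * form_norm N q k \<omega>"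
proof -
  define A where "A x = covector_norm (metric M x) k (pullback M N f \<omega> x)" for x
  define B where "B z = covector_norm (metric N z) k (\<omega> z)" for z
  define W where "W x = B (f x)" for x
  define J where "J = jacobian M N f"
  define s where "s = sigma M N k f"
  have alt: "alternating_form k (\<omega> z)" for z using \<omega>(1) by (simp add: measurable_form_def)
  have Am: "A \<in> borel_measurable (volume M)"
    unfolding A_def by (rule covector_norm_measurable[OF M measurable_form_pullback[OF \<omega>(1)]])
  have Bm: "B \<in> borel_measurable (volume N)"
    unfolding B_def by (rule covector_norm_measurable[OF N \<omega>(1)])
  have Wm: "W \<in> borel_measurable (volume M)" unfolding W_def using f_measurable Bm by (rule measurable_compose)
  have Jm: "J \<in> borel_measurable (volume M)" unfolding J_def by (rule jacobian_measurable)
  have Jpos: "J x > 0" for x unfolding J_def by (rule jacobian_pos)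
  have nn: "A x \<ge> 0" "B z \<ge> 0" "W x \<ge> 0" for x z by (simp_all add: A_def B_def W_def covector_norm_nonneg)
  have AsW: "A x \<le> s x * W x" for x
    unfolding A_def s_def W_def B_def by (rule covector_norm_pullback[OF alt])
  have p0: "p > 0" "q > 0" using pq by auto
  define P where "P = (\<integral>\<^sup>+x. ennreal (A x powr p) \<partial>volume M)"
  define Q where "Q = (\<integral>\<^sup>+z. ennreal (B z powr q) \<partial>volume N)"
  have normM: "form_norm M p k (pullback M N f \<omega>) = epowr P (1 / p)"
    using p0 nn by (simp add: form_norm_def Lnorm_def P_def A_def)
  have normN: "form_norm N q k \<omega> = epowr Q (1 / q)"
    using p0 nn by (simp add: form_norm_def Lnorm_def Q_def B_def)
  have "Q \<noteq> \<infinity>" using \<omega>(2) unfolding normN by (auto simp: epowr_def)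
  then obtain Qr where Qr: "Q = ennreal Qr" "Qr \<ge> 0" by (cases Q) auto
  have QJ: "(\<integral>\<^sup>+x. ennreal (J x * W x powr q) \<partial>volume M) = ennreal Qr"
  proof -
    have "(\<lambda>z. ennreal (B z powr q)) \<in> borel_measurable (volume N)" using Bm by measurable
    then show ?thesis
      unfolding Qr(1)[symmetric] Q_def
      by (subst nn_integral_jacobian) (auto simp: J_def W_def ennreal_mult' less_imp_le[OF jacobian_pos])
  qed
  define K where "K = distortion M N q t k f"
  have "epowr P (1 / p) \<le> epowr K (1 / q) * epowr Q (1 / q)"
  \<comment> \<open>Treated separately because the distortion may be infinite and
    \<open>\<infinity> * 0\<close> is 0 in \<open>ennreal\<close>: here the pullback itself must be
    shown to vanish almost everywhere.\<close>
  proof (cases "Qr = 0")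
    case True
    then have "AE x in volume M. ennreal (J x * W x powr q) = 0"
      using QJ Jm Wm by (subst nn_integral_0_iff_AE[symmetric]) auto
    then have "AE x in volume M. ennreal (A x powr p) = 0"
    proof eventually_elim
      case (elim x)
      then have "J x * W x powr q = 0" using Jpos[of x] nn(3)[of x] by (simp add: ennreal_eq_0_iff mult_le_0_iff)
      then have "W x = 0" using Jpos[of x] by simp
      then have "A x = 0" using AsW[of x] nn(1)[of x] by simp
      then show ?case by simp
    qed
    then have "P = 0" unfolding P_def using Am by (subst nn_integral_0_iff_AE) auto
    then show ?thesis by (simp add: epowr_def)
  next
    case False
    then have Qpos: "Qr > 0" using Qr by simp
    show ?thesis
    proof (cases "K = \<infinity>")
      case True
      have "epowr K (1 / q) = \<infinity>" using True by (simp add: epowr_def)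
      moreover have "epowr Q (1 / q) \<noteq> 0" using Qpos by (simp add: Qr(1) epowr_ennreal ennreal_eq_0_iff)
      ultimately show ?thesis by (simp add: ennreal_top_mult)
    next
      case False
      show ?thesis
      proof (cases "p = q")
        case True
        obtain \<kappa> where \<kappa>: "K = ennreal \<kappa>" "\<kappa> \<ge> 0" using False by (cases K) auto
        have "K = esssup (volume M) (\<lambda>x. ennreal \<bar>s x powr q / J x\<bar>)"
          using True t by (simp add: K_def distortion_def Lnorm_def s_def J_def)
        then have "AE x in volume M. ennreal \<bar>s x powr q / J x\<bar> \<le> ennreal \<kappa>"
          using esssup_AE[of "\<lambda>x. ennreal \<bar>s x powr q / J x\<bar>" "volume M"] \<kappa>(1) by simp
        then have "AE x in volume M. ennreal (A x powr p) \<le> ennreal \<kappa> * ennreal (J x * W x powr q)"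
        proof eventually_elim
          case (elim x)
          have "s x powr q / J x \<le> \<kappa>" using elim \<kappa>(2) Jpos[of x] by (simp add: ennreal_le_iff)
          then have le: "s x powr q \<le> \<kappa> * J x" using Jpos[of x] by (simp add: field_simps)
          have "A x powr q \<le> \<kappa> * (J x * W x powr q)"
          proof (cases "W x = 0")
            case True
            then have "A x = 0" using AsW[of x] nn(1)[of x] by simp
            then show ?thesis using True by simp
          next
            case False
            then have "W x > 0" using nn(3)[of x] by simp
            \<comment> \<open>The sign of \<open>s x\<close>, needed to split the power of a
              product, is extracted from \<open>0 \<le> A x \<le> s x * W x\<close> with
              \<open>W x > 0\<close>.\<close>
            then have "s x \<ge> 0" using AsW[of x] nn(1)[of x] by (metis mult_less_0_iff not_less order_trans)
            have "A x powr q \<le> (s x * W x) powr q" using AsW nn p0 by (intro powr_mono2) auto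
            also have "\<dots> = s x powr q * W x powr q" using \<open>s x \<ge> 0\<close> nn by (simp add: powr_mult)
            also have "\<dots> \<le> (\<kappa> * J x) * W x powr q" using le by (intro mult_right_mono) auto
            finally show ?thesis by (simp add: mult.assoc)
          qed
          then show ?case
            using True \<kappa>(2) Jpos[of x] by (simp add: ennreal_mult[symmetric] less_imp_le ennreal_leI)
        qed
        then have "P \<le> (\<integral>\<^sup>+x. ennreal \<kappa> * ennreal (J x * W x powr q) \<partial>volume M)"
          unfolding P_def by (rule nn_integral_mono_AE)
        also have "\<dots> = ennreal (\<kappa> * Qr)"
          using Jm Wm \<kappa> Qr(2) by (subst nn_integral_cmult) (auto simp: QJ ennreal_mult)
        finally have "epowr P (1 / p) \<le> epowr (ennreal (\<kappa> * Qr)) (1 / p)"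
          using p0 by (intro epowr_mono) auto
        also have "\<dots> = epowr K (1 / q) * epowr Q (1 / q)"
          unfolding \<kappa>(1) Qr(1) using \<kappa>(2) Qr(2) True
          by (subst (1 2 3) epowr_ennreal) (simp_all add: powr_mult ennreal_mult)
        finally show ?thesis .
      next
        case neq: False
        then have lt: "p < q" using pq by simp
        define \<tau> where "\<tau> = p / (q - p)"
        have \<tau>: "\<tau> > 0" using lt p0 by (simp add: \<tau>_def)
        define T where "T = (\<integral>\<^sup>+x. ennreal (\<bar>s x powr q / J x\<bar> powr \<tau>) \<partial>volume M)"
        have K: "K = epowr T (1 / \<tau>)"
          using neq t \<tau> by (simp add: K_def distortion_def Lnorm_def s_def J_def T_def flip: \<tau>_def)
        then have "T \<noteq> \<infinity>" using False by (auto simp: epowr_def)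
        then obtain Tr where Tr: "T = ennreal Tr" "Tr \<ge> 0" by (cases T) auto
        \<comment> \<open>Where \<open>W x = 0\<close>, division by zero makes \<open>X x\<close>
          equal to 0; this is harmless since \<open>A x\<close> vanishes there too.\<close>
        define X where "X x = (A x / W x) powr p * J x powr (- p / q)" for x
        define Y where "Y x = (J x * W x powr q) powr (p / q)" for x
        have XY: "A x powr p = X x * Y x" for x
        proof (cases "W x = 0")
          case True
          then have "A x = 0" using AsW[of x] nn(1)[of x] by simp
          then show ?thesis using True p0 by (simp add: X_def Y_def)
        next
          case False
          then have "W x > 0" using nn(3)[of x] by simp
          then have "Y x = J x powr (p / q) * W x powr p"
            using Jpos[of x] p0 by (simp add: Y_def powr_mult powr_powr)
          moreover have "J x powr (- p / q) * J x powr (p / q) = 1"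
            using Jpos[of x] by (simp flip: powr_add)
          ultimately have "X x * Y x = (A x / W x) powr p * W x powr p" by (simp add: X_def)
          also have "\<dots> = A x powr p" using \<open>W x > 0\<close> nn(1)[of x] by (simp flip: powr_mult)
          finally show ?thesis by simp
        qed
        \<comment> \<open>The exponent conjugate to q / p. It satisfies p * b = q * \<tau> and (p /
          q) * b = \<tau>, which match the powers of the singular value sum and of the Jacobian in
          the integrand of \<open>T\<close>.\<close>
        define b where "b = q / (q - p)"
        have b: "b > 1" "q / p > 1" "1 / b + 1 / (q / p) = 1" using lt p0
          by (auto simp: b_def field_simps)
        have Xle: "X x powr b \<le> \<bar>s x powr q / J x\<bar> powr \<tau>" for x
        proof (cases "W x = 0")
          case True
          then show ?thesis using p0 by (simp add: X_def)
        next
          case False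
          then have "W x > 0" using nn(3)[of x] by simp
          then have As: "0 \<le> A x / W x" "A x / W x \<le> s x" using AsW[of x] nn(1)[of x] by (simp_all add: field_simps)
          have "X x powr b = (A x / W x) powr (q * \<tau>) * J x powr (- \<tau>)"
            using As Jpos[of x] p0 lt by (simp add: X_def powr_mult powr_powr b_def \<tau>_def field_simps)
          also have "\<dots> \<le> s x powr (q * \<tau>) * J x powr (- \<tau>)"
            using As p0 \<tau> by (intro mult_right_mono powr_mono2) auto
          also have "\<dots> = (s x powr q / J x) powr \<tau>"
            using Jpos[of x] by (simp add: powr_divide powr_powr powr_minus_divide)
          finally show ?thesis using Jpos[of x] by simp
        qed
        have Xm: "X \<in> borel_measurable (volume M)" unfolding X_def using Am Wm Jm by measurable
        have Ym: "Y \<in> borel_measurable (volume M)" unfolding Y_def using Wm Jm by measurable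
        \<comment> \<open>Monotonicity of the integral holds for arbitrary functions, so the
          integrand of \<open>T\<close> may be non-measurable.\<close>
        have XT: "(\<integral>\<^sup>+x. ennreal (X x powr b) \<partial>volume M) \<le> ennreal Tr"
          unfolding Tr(1)[symmetric] T_def by (intro nn_integral_mono ennreal_leI Xle)
        then obtain R where R: "(\<integral>\<^sup>+x. ennreal (X x powr b) \<partial>volume M) = ennreal R" "R \<ge> 0"
          by (cases "\<integral>\<^sup>+x. ennreal (X x powr b) \<partial>volume M") (auto simp: top_unique)
        have RT: "R \<le> Tr" using XT Tr(2) unfolding R(1) by simp
        have YQ: "(\<integral>\<^sup>+x. ennreal (Y x powr (q / p)) \<partial>volume M) = ennreal Qr"
          unfolding QJ[symmetric]
          by (intro nn_integral_cong) (use p0 Jpos in \<open>simp add: Y_def powr_powr less_imp_le\<close>)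
        have "P = (\<integral>\<^sup>+x. ennreal (X x * Y x) \<partial>volume M)" by (simp add: P_def XY)
        also have "\<dots> \<le> ennreal (R powr (1 / b) * Qr powr (1 / (q / p)))"
          by (rule nn_integral_Holder[OF Xm _ Ym _ b R YQ Qr(2)]) (auto simp: X_def Y_def)
        also have "\<dots> \<le> ennreal (Tr powr (1 / b) * Qr powr (p / q))"
          using RT R(2) b p0 by (intro ennreal_leI mult_mono powr_mono2) auto
        finally have "epowr P (1 / p) \<le> epowr (ennreal (Tr powr (1 / b) * Qr powr (p / q))) (1 / p)"
          using p0 by (intro epowr_mono) auto
        \<comment> \<open>Here 1 / (b * p) = (q - p) / (p * q) = 1 / (\<tau> * q), so the first
          factor is the root of order q of the distortion.\<close>
        also have "\<dots> = ennreal ((Tr powr (1 / \<tau>)) powr (1 / q) * Qr powr (1 / q))"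
          using p0 lt by (simp add: epowr_ennreal powr_mult powr_powr b_def \<tau>_def field_simps)
        also have "\<dots> = epowr K (1 / q) * epowr Q (1 / q)"
          by (simp add: K Tr Qr epowr_ennreal ennreal_mult)
        finally show ?thesis .
      qed
    qed
  qed
  then show ?thesis by (simp only: normM normN K_def)
qed

end

theorem proposition4p1:
  fixes M :: "('a::{t2_space,second_countable_topology}, 'n::{finite,wellorder}) riem"
    and N :: "('b::{t2_space,second_countable_topology}, 'n) riem"
    and f :: "'a \<Rightarrow> 'b" and k :: nat and p q :: real and t :: ennreal
  assumes "oriented_riemannian_manifold M" and "oriented_riemannian_manifold N"
    and "k \<le> CARD('n)"
    and "diffeomorphism M N f"
    and "1 \<le> p" and "p \<le> q"
    and "t = (if p = q then \<infinity> else ennreal (p / (q - p)))"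
  shows "(\<forall>\<omega>\<in>Lp_forms N q k.
            measurable_form M k (pullback M N f \<omega>) \<and>
            form_norm M p k (pullback M N f \<omega>)
              \<le> epowr (distortion M N q t k f) (1 / q) * form_norm N q k \<omega>)
         \<and> (f \<in> BD M N q t k \<longrightarrow> bounded_form_operator N q M p k (pullback M N f))"
proof -
  interpret riemannian_diffeo M N f using assms by unfold_locales
  have main: "measurable_form M k (pullback M N f \<omega>)"
      "form_norm M p k (pullback M N f \<omega>) \<le> epowr (distortion M N q t k f) (1 / q) * form_norm N q k \<omega>"
    if "\<omega> \<in> Lp_forms N q k" for \<omega>
    using that measurable_form_pullback form_norm_pullback_le[OF _ _ assms(5-7)] by (auto simp: Lp_forms_def)
  have "bounded_form_operator N q M p k (pullback M N f)" if "f \<in> BD M N q t k"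
  proof -
    define K where "K = epowr (distortion M N q t k f) (1 / q)"
    have "K < \<infinity>" using that by (auto simp: K_def BD_def epowr_def)
    \<comment> \<open>Membership in \<open>BD\<close> makes the factor finite, so it can serve as
      the real bound \<open>C\<close> of the operator.\<close>
    then have K: "K = ennreal (enn2real K)" by (simp add: less_top)
    show ?thesis
      unfolding bounded_form_operator_def
    proof (intro conjI ballI impI allI)
      show "pullback M N f \<omega> \<in> Lp_forms M p k" if \<omega>: "\<omega> \<in> Lp_forms N q k" for \<omega>
      proof -
        have "K * form_norm N q k \<omega> < \<infinity>"
          using \<omega> \<open>K < \<infinity>\<close> by (simp add: Lp_forms_def ennreal_mult_less_top)
        then have "form_norm M p k (pullback M N f \<omega>) < \<infinity>" using main(2)[OF \<omega>] unfolding K_def by (rule le_less_trans[rotated])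
        then show ?thesis using main(1)[OF \<omega>] by (simp add: Lp_forms_def)
      qed
      show "AE x in volume M. pullback M N f \<omega> x = pullback M N f \<eta> x" if "AE y in volume N. \<omega> y = \<eta> y" for \<omega> \<eta>
        using AE_volume_pullback[OF that] by eventually_elim (simp add: pullback_def)
      show "pullback M N f (\<lambda>y v. a * \<omega> y v + b * \<eta> y v) =
          (\<lambda>x v. a * pullback M N f \<omega> x v + b * pullback M N f \<eta> x v)" for \<omega> \<eta> a b
        by (simp add: pullback_def)
      show "\<exists>C::real. \<forall>\<omega>\<in>Lp_forms N q k. form_norm M p k (pullback M N f \<omega>) \<le> ennreal C * form_norm N q k \<omega>"
        using main(2) K unfolding K_def by metis
    qed
  qed
  then show ?thesis using main by blast
qed

end
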